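(* Let $p > 2$ be an even integer. Then the complex initial value problem $s' = c^{p-1}$, $c' = -s^{p-1}$, $s(0)=0$, $c(0)=1$ has a unique holomorphic solution pair $(s,c)$ in the open polygonal band $\mathcal{P}$.
   Context: Let $K_p := \int_0^1 \frac{d\zeta}{(1+\zeta^p)^{2/p}} > 0$. Let $\mathbb{P} \subset \mathbb{C}$ be the open regular $p$-gon that is centred at $0$ and has the positive real number $K_p$ as the midpoint of one of its edges. For $p$ even, $\mathcal{P}$ is the union of the translates $\mathbb{P} + 2nK_p$ ($n \in \mathbb{Z}$) together with the open segments (open edges, without the vertices) that lie between adjacent translates, i.e. the common open edges centred at the points $(2n+1)K_p$, $n\in\mathbb{Z}$. Thus $\mathcal{P}$ is an open neighbourhood of the real axis. A holomorphic solution pair on a connected open set $U \ni 0$ is a pair of holomorphic functions $s,c : U \to \mathbb{C}$ satisfying the differential equations on $U$ and the initial conditions at $0$. *)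

theory Defs
  imports "HOL-Complex_Analysis.Complex_Analysis"
begin

definition K :: "nat \<Rightarrow> real" where
  "K p = integral {0..1} (\<lambda>\<zeta>::real. 1 / (1 + \<zeta> ^ p) powr (2 / real p))"

(* The regular p-gon centred at 0 with K p as an edge midpoint has inradius K p, hence
   circumradius K p / cos (pi / p), and its vertices lie at the odd multiples of the angle pi / p. *)
definition pgon_vertex :: "nat \<Rightarrow> int \<Rightarrow> complex" where
  "pgon_vertex p k = of_real (K p / cos (pi / real p)) * cis ((2 * of_int k + 1) * pi / real p)"

definition open_pgon :: "nat \<Rightarrow> complex set" where
  "open_pgon p = interior (convex hull (pgon_vertex p ` {0..<int p}))"

(* The vertices with indices -1 and 0 are the end points of the edge with midpoint K p. *)
definition right_open_edge :: "nat \<Rightarrow> complex set" where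
  "right_open_edge p = open_segment (pgon_vertex p (- 1)) (pgon_vertex p 0)"

(* Translated by 2 n K p, the right edge is the common edge, centred at (2 n + 1) K p, of the
   n-th and the (n + 1)-st translate (for even p). *)
definition polygonal_band :: "nat \<Rightarrow> complex set" where
  "polygonal_band p =
     (\<Union>n::int. (\<lambda>z. z + of_real (2 * of_int n * K p)) ` open_pgon p) \<union>
     (\<Union>n::int. (\<lambda>z. z + of_real (2 * of_int n * K p)) ` right_open_edge p)"

definition holomorphic_solution_pair ::
    "nat \<Rightarrow> complex set \<Rightarrow> (complex \<Rightarrow> complex) \<Rightarrow> (complex \<Rightarrow> complex) \<Rightarrow> bool" where
  "holomorphic_solution_pair p U s c \<longleftrightarrow>
     open U \<and> connected U \<and> 0 \<in> U \<and>
     s holomorphic_on U \<and> c holomorphic_on U \<and>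
     (\<forall>z\<in>U. (s has_field_derivative c z ^ (p - 1)) (at z)) \<and>
     (\<forall>z\<in>U. (c has_field_derivative - (s z ^ (p - 1))) (at z)) \<and>
     s 0 = 0 \<and> c 0 = 1"

end

theory Submission
  imports Defs
begin

text \<open>
  Along a solution \<open>s\<^sup>p + c\<^sup>p = 1\<close>, so \<open>t = s / c\<close> satisfies \<open>t' = (1 + t\<^sup>p) powr (2 / p)\<close>; that is, \<open>t\<close> inverts
  the Schwarz--Christoffel map \<open>f\<close> with \<open>f' = (1 + w\<^sup>p) powr (- 2 / p)\<close>. As \<open>p \<ge> 4\<close>, \<open>f'\<close> has positive
  real part on the plane slit along the rays beyond the \<open>p\<close>-th roots of \<open>-1\<close>, so \<open>f\<close> is injective on
  convex subsets. It maps the unit arcs onto the edges of the polygon, so by a clopen argument \<open>f\<close> of the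
  disc covers the polygon. The inverse branch on the sector \<open>\<bar>arg w\<bar> < pi / p\<close> continues the solution
  across the right edge, where the symmetry \<open>z \<mapsto> 2 K - z\<close>, \<open>(s, c) \<mapsto> (c, s)\<close> and uniqueness yield
  \<open>s (z + 2 K) = c z\<close> and \<open>c (z + 2 K) = - s z\<close>; this extends the solution to the whole band.
\<close>

section \<open>The differential system: uniqueness and symmetries\<close>

text \<open>What is known on the open unit arcs is therefore carried inwards to circles of radius
  \<open>r < 1\<close> by a bound \<open>\<delta> r\<close> on radial increments that does not
  depend on the direction and tends to 0; on such a circle the critical directions are reached by
  plain continuity. Only the inclusion of the polygon in the image of the disc is needed. For it, it
  suffices that values \<open>f w\<close> with \<open>w\<close> close to the unit circle lie close
  to, or beyond, some edge line, hence cannot accumulate inside the polygon. Two inverse branches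
  are used because neither domain is enough: the disc leaves no room beyond an edge, and the sector
  sees one edge only. They agree to the left of the edge line because \<open>Re f\<close> increases
  along the rays of the sector and equals \<open>K p\<close> on the unit arc.\<close>

definition solves :: "nat \<Rightarrow> complex set \<Rightarrow> (complex \<Rightarrow> complex) \<Rightarrow> (complex \<Rightarrow> complex) \<Rightarrow> bool" where
  "solves p U s c \<longleftrightarrow>
     (\<forall>z\<in>U. (s has_field_derivative c z ^ (p - 1)) (at z) \<and>
            (c has_field_derivative - (s z ^ (p - 1))) (at z))"

lemma solves_subset: "solves p U s c \<Longrightarrow> V \<subseteq> U \<Longrightarrow> solves p V s c"
  by (auto simp: solves_def)

lemma solves_holomorphic:
  assumes "solves p U s c" shows "s holomorphic_on U" "c holomorphic_on U"
  using assms unfolding solves_def holomorphic_on_def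
  by (meson field_differentiable_at_within field_differentiable_def)+

text \<open>A Picard estimate. The factor \<open>W\<close> in
  \<open>x ^ (p - 1) - y ^ (p - 1) = (x - y) * W\<close> is bounded by \<open>L\<close> on a compact
  ball. On a ball with \<open>4 * L * d \<le> 1\<close> the mean value inequality bounds the maximum
  of \<open>norm u + norm v\<close> by half of itself, so it is 0.\<close>

lemma solves_unique_local:
  assumes "open U" "z0 \<in> U" and sol: "solves p U s c" "solves p U s' c'"
    and eq: "s z0 = s' z0" "c z0 = c' z0"
  obtains d where "d > 0" "cball z0 d \<subseteq> U" "\<And>z. z \<in> cball z0 d \<Longrightarrow> s z = s' z \<and> c z = c' z"
proof -
  obtain r where r: "r > 0" "cball z0 r \<subseteq> U"
    using assms(1,2) open_contains_cball by blast
  define W where "W f g z = (\<Sum>i<p-1. g z ^ (p - 1 - Suc i) * f z ^ i)" for f g :: "complex \<Rightarrow> complex" and z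
  have bdd: "\<exists>L. \<forall>z\<in>cball z0 r. norm (W f g z) \<le> L"
    if "f holomorphic_on U" "g holomorphic_on U" for f g
  proof -
    have "continuous_on (cball z0 r) f" "continuous_on (cball z0 r) g"
      using that r(2) holomorphic_on_imp_continuous_on continuous_on_subset by blast+
    then have "continuous_on (cball z0 r) (W f g)"
      unfolding W_def by (intro continuous_intros)
    then have "bounded (W f g ` cball z0 r)"
      by (intro compact_imp_bounded compact_continuous_image) auto
    then show ?thesis by (auto simp: bounded_iff)
  qed
  obtain L1 L2 where L12: "\<And>z. z \<in> cball z0 r \<Longrightarrow> norm (W c c' z) \<le> L1"
      "\<And>z. z \<in> cball z0 r \<Longrightarrow> norm (W s s' z) \<le> L2"
    using bdd[of c c'] bdd[of s s'] solves_holomorphic[OF sol(1)] solves_holomorphic[OF sol(2)] by metis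
  define L where "L = \<bar>L1\<bar> + \<bar>L2\<bar> + 1"
  have L: "L > 0" "\<And>z. z \<in> cball z0 r \<Longrightarrow> norm (W c c' z) \<le> L"
      "\<And>z. z \<in> cball z0 r \<Longrightarrow> norm (W s s' z) \<le> L"
    using L12 unfolding L_def by (auto, (smt (verit))+)
  define d where "d = min r (1 / (4 * L))"
  have d: "d > 0" "d \<le> r" "4 * L * d \<le> 1"
    using r L by (auto simp: d_def min_def field_simps)
  define u v where "u z = s z - s' z" and "v z = c z - c' z" for z
  have dsub: "cball z0 d \<subseteq> U" "cball z0 d \<subseteq> cball z0 r"
    using d r by auto
  have du: "(u has_field_derivative v z * W c c' z) (at z)" if "z \<in> cball z0 d" for z
  proof -
    have "z \<in> U" using that dsub by auto
    then have "((\<lambda>z. s z - s' z) has_field_derivative c z ^ (p - 1) - c' z ^ (p - 1)) (at z)"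
      using sol by (auto simp: solves_def intro!: derivative_intros)
    then show ?thesis unfolding u_def v_def W_def by (subst power_diff_sumr2[symmetric])
  qed
  have dv: "(v has_field_derivative - (u z * W s s' z)) (at z)" if "z \<in> cball z0 d" for z
  proof -
    have "z \<in> U" using that dsub by auto
    then have "((\<lambda>z. c z - c' z) has_field_derivative - (s z ^ (p - 1)) - - (s' z ^ (p - 1))) (at z)"
      using sol by (intro derivative_intros) (auto simp: solves_def)
    then show ?thesis unfolding u_def v_def W_def by (subst power_diff_sumr2[symmetric]) simp
  qed
  have "continuous_on (cball z0 d) (\<lambda>z. norm (u z) + norm (v z))"
    using du dv by (intro continuous_intros DERIV_continuous_on[where f=u] DERIV_continuous_on[where f=v])
      (auto intro: has_field_derivative_at_within)
  then obtain x where x: "x \<in> cball z0 d"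
    and xmax: "\<And>y. y \<in> cball z0 d \<Longrightarrow> norm (u y) + norm (v y) \<le> norm (u x) + norm (v x)"
    using continuous_attains_sup[of "cball z0 d" "\<lambda>z. norm (u z) + norm (v z)"] d by force
  define m where "m = norm (u x) + norm (v x)"
  have m0: "m \<ge> 0" by (simp add: m_def)
  have um: "norm (u y) \<le> m" "norm (v y) \<le> m" if "y \<in> cball z0 d" for y
    using xmax[OF that] norm_ge_zero[of "u y"] norm_ge_zero[of "v y"] unfolding m_def by linarith+
  have "norm (u x - u z0) \<le> (m * L) * norm (x - z0)"
    using um L dsub x d m0
    by (intro field_differentiable_bound[where f=u and S="cball z0 d" and f'="\<lambda>z. v z * W c c' z"])
       (auto simp: norm_mult intro!: mult_mono has_field_derivative_at_within du)
  moreover have "norm (v x - v z0) \<le> (m * L) * norm (x - z0)"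
    using um L dsub x d m0
    by (intro field_differentiable_bound[where f=v and S="cball z0 d" and f'="\<lambda>z. - (u z * W s s' z)"])
       (auto simp: norm_mult intro!: mult_mono has_field_derivative_at_within dv)
  moreover have "(m * L) * norm (x - z0) \<le> (m * L) * d"
    using x m0 L(1) by (intro mult_left_mono) (auto simp: dist_norm norm_minus_commute)
  moreover have "u z0 = 0" "v z0 = 0" using eq by (auto simp: u_def v_def)
  ultimately have "m \<le> 2 * (m * L * d)" unfolding m_def by simp
  also have "\<dots> = m * (4 * L * d) / 2" by simp
  also have "\<dots> \<le> m * 1 / 2" using m0 d by (intro divide_right_mono mult_left_mono) auto
  finally have "m = 0" using m0 by simp
  then have "s z = s' z \<and> c z = c' z" if "z \<in> cball z0 d" for z
    using um[OF that] by (simp add: u_def v_def)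
  then show ?thesis using that d dsub by blast
qed

lemma solves_unique:
  assumes "open U" "connected U" "z0 \<in> U" and sol: "solves p U s c" "solves p U s' c'"
    and eq: "s z0 = s' z0" "c z0 = c' z0" and "z \<in> U"
  shows "s z = s' z" "c z = c' z"
proof -
  obtain d where d: "d > 0" "cball z0 d \<subseteq> U" "\<And>z. z \<in> cball z0 d \<Longrightarrow> s z = s' z \<and> c z = c' z"
    using solves_unique_local[OF assms(1,3-7)] by blast
  have *: "ball z0 d \<subseteq> U" "ball z0 d \<noteq> {}"
    using d ball_subset_cball by (blast, simp)
  show "s z = s' z"
    by (rule analytic_continuation_open[of "ball z0 d" U s s'])
       (use * d assms solves_holomorphic[OF sol(1)] solves_holomorphic[OF sol(2)] in auto)
  show "c z = c' z"
    by (rule analytic_continuation_open[of "ball z0 d" U c c'])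
       (use * d assms solves_holomorphic[OF sol(1)] solves_holomorphic[OF sol(2)] in auto)
qed

text \<open>A derivative depends only on the germ at the point. This is the gluing principle for the
  band: the local pair may vary from point to point.\<close>

lemma solves_local:
  assumes "\<And>z. z \<in> U \<Longrightarrow> \<exists>V s' c'. open V \<and> z \<in> V \<and> solves p V s' c' \<and> (\<forall>y\<in>V. s y = s' y \<and> c y = c' y)"
  shows "solves p U s c"
  unfolding solves_def
proof
  fix z assume "z \<in> U"
  then obtain V s' c' where V: "open V" "z \<in> V" and sol: "solves p V s' c'"
    and eq: "\<And>y. y \<in> V \<Longrightarrow> s' y = s y" "\<And>y. y \<in> V \<Longrightarrow> c' y = c y"
    using assms by metis
  have "(s' has_field_derivative c z ^ (p - 1)) (at z)" "(c' has_field_derivative - (s z ^ (p - 1))) (at z)"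
    using sol V eq by (auto simp: solves_def)
  then show "(s has_field_derivative c z ^ (p - 1)) (at z) \<and> (c has_field_derivative - (s z ^ (p - 1))) (at z)"
    using has_field_derivative_transform_within_open[OF _ V] eq by metis
qed

text \<open>Reversing the variable changes the sign of both derivatives, and exchanging the
  components changes it back.\<close>

lemma solves_reflect:
  assumes "solves p U s c"
  shows "solves p {z. a - z \<in> U} (\<lambda>z. c (a - z)) (\<lambda>z. s (a - z))"
  unfolding solves_def
proof (intro ballI conjI)
  fix z assume z: "z \<in> {z. a - z \<in> U}"
  have m: "((\<lambda>z. a - z) has_field_derivative -1) (at z)"
    by (auto intro!: derivative_eq_intros)
  have "((\<lambda>z. c (a - z)) has_field_derivative - (s (a - z) ^ (p - 1)) * -1) (at z)"
    using assms z by (intro DERIV_chain2[where f=c, OF _ m]) (auto simp: solves_def)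
  then show "((\<lambda>z. c (a - z)) has_field_derivative s (a - z) ^ (p - 1)) (at z)" by simp
  have "((\<lambda>z. s (a - z)) has_field_derivative (c (a - z) ^ (p - 1)) * -1) (at z)"
    using assms z by (intro DERIV_chain2[where f=s, OF _ m]) (auto simp: solves_def)
  then show "((\<lambda>z. s (a - z)) has_field_derivative - (c (a - z) ^ (p - 1))) (at z)" by simp
qed

text \<open>The system is invariant under the quarter turn \<open>(s, c) \<mapsto> (c, -s)\<close> because \<open>p - 1\<close> is odd;
  \<open>rot_a n\<close> and \<open>rot_b n\<close> are the cosine and the sine of \<open>n\<close> quarter turns.\<close>

definition rot_a :: "int \<Rightarrow> complex" where
  "rot_a n = (if n mod 4 = 0 then 1 else if n mod 4 = 2 then -1 else 0)"

definition rot_b :: "int \<Rightarrow> complex" where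
  "rot_b n = rot_a (n - 1)"

lemma rot_b_Suc: "rot_b (n + 1) = rot_a n" and rot_a_Suc: "rot_a (n + 1) = - rot_b n"
proof -
  show "rot_b (n + 1) = rot_a n" by (simp add: rot_b_def)
  have "(n + 1) mod 4 = 0 \<longleftrightarrow> (n - 1) mod 4 = 2" "(n + 1) mod 4 = 2 \<longleftrightarrow> (n - 1) mod 4 = 0"
    by presburger+
  then show "rot_a (n + 1) = - rot_b n" by (auto simp: rot_a_def rot_b_def)
qed

lemma rot_cases:
  obtains "rot_a n = 1" "rot_b n = 0" | "rot_a n = 0" "rot_b n = 1"
    | "rot_a n = -1" "rot_b n = 0" | "rot_a n = 0" "rot_b n = -1"
proof -
  have "n mod 4 = 0 \<and> (n - 1) mod 4 = 3 \<or> n mod 4 = 1 \<and> (n - 1) mod 4 = 0 \<or>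
        n mod 4 = 2 \<and> (n - 1) mod 4 = 1 \<or> n mod 4 = 3 \<and> (n - 1) mod 4 = 2"
    by presburger
  then show ?thesis using that by (auto simp: rot_a_def rot_b_def)
qed

lemma solves_rot_shift:
  assumes "solves p U s c" "even p" "p > 0"
  shows "solves p ((\<lambda>z. z + h) ` U)
    (\<lambda>z. rot_a n * s (z - h) + rot_b n * c (z - h)) (\<lambda>z. rot_a n * c (z - h) - rot_b n * s (z - h))"
  unfolding solves_def
proof (intro ballI)
  fix z assume "z \<in> (\<lambda>z. z + h) ` U"
  then have z: "z - h \<in> U" by auto
  have m: "((\<lambda>z. z - h) has_field_derivative 1) (at z)"
    by (auto intro!: derivative_eq_intros)
  have 1: "((\<lambda>z. c (z - h)) has_field_derivative - (s (z - h) ^ (p - 1)) * 1) (at z)"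
    using assms z by (intro DERIV_chain2[where f=c, OF _ m]) (auto simp: solves_def)
  have 2: "((\<lambda>z. s (z - h)) has_field_derivative (c (z - h) ^ (p - 1)) * 1) (at z)"
    using assms z by (intro DERIV_chain2[where f=s, OF _ m]) (auto simp: solves_def)
  have odd: "odd (p - 1)" and "p - 1 > 0" using assms by auto
  have 3: "((\<lambda>z. rot_a n * s (z - h) + rot_b n * c (z - h)) has_field_derivative
      rot_a n * (c (z - h) ^ (p - 1)) - rot_b n * (s (z - h) ^ (p - 1))) (at z)"
    using 1 2 by (auto intro!: derivative_eq_intros)
  have 4: "((\<lambda>z. rot_a n * c (z - h) - rot_b n * s (z - h)) has_field_derivative
      - (rot_a n * (s (z - h) ^ (p - 1)) + rot_b n * (c (z - h) ^ (p - 1)))) (at z)"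
    using 1 2 by (auto intro!: derivative_eq_intros)
  show "((\<lambda>z. rot_a n * s (z - h) + rot_b n * c (z - h)) has_field_derivative
           (rot_a n * c (z - h) - rot_b n * s (z - h)) ^ (p - 1)) (at z) \<and>
         ((\<lambda>z. rot_a n * c (z - h) - rot_b n * s (z - h)) has_field_derivative
           - ((rot_a n * s (z - h) + rot_b n * c (z - h)) ^ (p - 1))) (at z)"
    \<comment> \<open>In each of the four cases one coefficient is 0 and the other is 1 or -1, so
      the power of the combination is a single power, and the odd exponent preserves its
      sign.\<close>
    using 3 4 odd by (cases rule: rot_cases[of n]) (simp_all add: power_minus_odd)
qed

section \<open>The Schwarz--Christoffel map\<close>

locale sc_polygon =
  fixes p :: nat
  assumes p_gt: "p > 2" and p_even: "even p"
begin

lemma p_ge: "p \<ge> 4"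
  using p_gt p_even by presburger

text \<open>Keeping \<open>1 + z ^ p\<close> off the cut of the principal logarithm removes exactly
  the closed rays that start at the \<open>p\<close>-th roots of -1 and point away from 0.\<close>

definition \<Omega> :: "complex set" where
  "\<Omega> = {z. 1 + z ^ p \<notin> \<real>\<^sub>\<le>\<^sub>0}"

text \<open>This is \<open>f'\<close>, the power of \<open>1 + z ^ p\<close> with exponent
  \<open>- 2 / p\<close>; through \<open>Ln\<close> its modulus and argument can be read off
  separately.\<close>

definition q :: "complex \<Rightarrow> complex" where
  "q z = exp (- (2 / of_nat p) * Ln (1 + z ^ p))"

lemma open_\<Omega>: "open \<Omega>"
proof -
  have "\<Omega> = (\<lambda>z. 1 + z ^ p) -` (- \<real>\<^sub>\<le>\<^sub>0)" by (auto simp: \<Omega>_def)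
  then show ?thesis
    by (auto intro!: open_vimage open_Compl closed_nonpos_Reals_complex continuous_intros)
qed

text \<open>A point on a slit stays on the slit when it moves outwards: if
  \<open>u ^ p * z ^ p\<close> is real and at most -1, so is \<open>z ^ p\<close>.\<close>

lemma scale_\<Omega>:
  assumes "z \<in> \<Omega>" "0 \<le> u" "u \<le> 1" shows "of_real u * z \<in> \<Omega>"
proof (rule ccontr)
  assume "of_real u * z \<notin> \<Omega>"
  then have *: "1 + u ^ p * Re (z ^ p) \<le> 0" "u ^ p * Im (z ^ p) = 0"
    by (auto simp: \<Omega>_def complex_nonpos_Reals_iff power_mult_distrib simp flip: of_real_power)
  have u: "0 \<le> u ^ p" "u ^ p \<le> 1" using assms by (auto simp: power_le_one)
  then have up: "u ^ p > 0" using *(1) by (cases "u ^ p = 0") (simp_all del: power_eq_0_iff)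
  then have "Im (z ^ p) = 0" using *(2) up by (metis less_irrefl mult_eq_0_iff)
  moreover have "1 + Re (z ^ p) \<le> 0"
  proof (rule ccontr)
    assume "\<not> ?thesis"
    then have "u ^ p * Re (z ^ p) > u ^ p * (-1)" using up by (intro mult_strict_left_mono) auto
    then show False using * u by simp
  qed
  ultimately show False using assms by (simp add: \<Omega>_def complex_nonpos_Reals_iff)
qed

lemma zero_\<Omega>: "0 \<in> \<Omega>"
  using p_gt by (simp add: \<Omega>_def complex_nonpos_Reals_iff power_0_left)

lemma starlike_\<Omega>: "starlike \<Omega>"
  unfolding starlike_def
proof (intro bexI ballI subsetI)
  fix z w assume z: "z \<in> \<Omega>" and w: "w \<in> closed_segment 0 z"
  then obtain u where "w = u *\<^sub>R z" "0 \<le> u" "u \<le> 1" by (auto simp: in_segment)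
  then show "w \<in> \<Omega>" using scale_\<Omega>[OF z] by (simp add: scaleR_conv_of_real)
qed (rule zero_\<Omega>)

lemma connected_\<Omega>: "connected \<Omega>"
  by (rule starlike_imp_connected[OF starlike_\<Omega>])

lemma mult_root_\<Omega>: "a ^ p = 1 \<Longrightarrow> a * z \<in> \<Omega> \<longleftrightarrow> z \<in> \<Omega>"
  by (simp add: \<Omega>_def power_mult_distrib)

lemma cnj_\<Omega>: "cnj z \<in> \<Omega> \<longleftrightarrow> z \<in> \<Omega>"
  by (simp add: \<Omega>_def complex_nonpos_Reals_iff flip: complex_cnj_power)

lemma Re_one_plus_power_pos: "norm z < 1 \<Longrightarrow> Re (1 + z ^ p) > 0"
proof -
  assume "norm z < 1"
  then have "norm (z ^ p) < 1"
    using p_gt by (simp add: norm_power power_less_one_iff)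
  then show ?thesis using abs_Re_le_cmod[of "z ^ p"] by simp
qed

lemma ball_\<Omega>: "ball 0 1 \<subseteq> \<Omega>"
  using Re_one_plus_power_pos by (fastforce simp: \<Omega>_def complex_nonpos_Reals_iff)

lemma holomorphic_q: "q holomorphic_on \<Omega>"
  unfolding q_def by (intro holomorphic_intros) (auto simp: \<Omega>_def)

lemma q_eq_polar:
  assumes "1 + z ^ p \<noteq> 0"
  shows "q z = of_real (exp (- (2 / p) * ln (norm (1 + z ^ p)))) * cis (- (2 / p) * Im (Ln (1 + z ^ p)))"
proof -
  have "Ln (1 + z ^ p) = of_real (ln (norm (1 + z ^ p))) + \<i> * of_real (Im (Ln (1 + z ^ p)))"
    using assms by (intro complex_eqI) auto
  then have "- (2 / of_nat p) * Ln (1 + z ^ p) = of_real (- (2 / p) * ln (norm (1 + z ^ p)))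
       + \<i> * of_real (- (2 / p) * Im (Ln (1 + z ^ p)))"
    by (metis (no_types, opaque_lifting) distrib_left mult.left_commute of_real_divide of_real_minus
        of_real_mult of_real_numeral of_real_of_nat_eq)
  then have "q z = exp (of_real (- (2 / p) * ln (norm (1 + z ^ p))))
       * exp (\<i> * of_real (- (2 / p) * Im (Ln (1 + z ^ p))))"
    unfolding q_def by (metis exp_add)
  then show ?thesis by (simp only: exp_of_real cis_conv_exp)
qed

lemma norm_q:
  assumes "1 + z ^ p \<noteq> 0"
  shows "norm (q z) = norm (1 + z ^ p) powr (- (2 / p))"
  using assms by (subst q_eq_polar) (auto simp: norm_mult powr_def)

text \<open>The argument of \<open>1 + z ^ p\<close> is strictly below \<open>pi\<close> in modulus,
  and \<open>p \<ge> 4\<close> makes the factor \<open>2 / p\<close> at most 1/2, so the argument of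
  \<open>q z\<close> stays strictly within a right angle.\<close>

lemma Re_q_pos:
  assumes "z \<in> \<Omega>" shows "Re (q z) > 0"
proof -
  let ?L = "Ln (1 + z ^ p)"
  have nz: "1 + z ^ p \<noteq> 0" using assms by (auto simp: \<Omega>_def)
  have "\<bar>Im ?L\<bar> < pi"
    using Im_Ln_less_pi[of "1 + z ^ p"] mpi_less_Im_Ln[of "1 + z ^ p"] assms nz by (auto simp: \<Omega>_def)
  then have "(2 / p) * \<bar>Im ?L\<bar> < (2 / p) * pi"
    using p_gt by (intro mult_strict_left_mono) auto
  also have "\<dots> \<le> pi / 2" using p_ge by (simp add: field_simps)
  finally have "\<bar>- (2 / p) * Im ?L\<bar> < pi / 2" by (simp add: abs_mult)
  then have "cos (- (2 / p) * Im ?L) > 0" by (intro cos_gt_zero_pi) linarith+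
  then show ?thesis using nz by (subst q_eq_polar) auto
qed

text \<open>\<open>1 + z ^ p\<close> has modulus at least \<open>1 - norm z ^ p\<close>, hence at
  least \<open>1 - norm z\<close>, and the negative exponent reverses the inequality. The bound is
  the same in all directions, even towards the singular points.\<close>

lemma norm_q_le:
  assumes "norm z < 1"
  shows "norm (q z) \<le> (1 - norm z) powr (- (2 / p))"
proof -
  have nz: "1 + z ^ p \<noteq> 0" using Re_one_plus_power_pos[OF assms] by (metis less_irrefl zero_complex.sel(1))
  have "norm z ^ p \<le> norm z ^ 1" using assms p_gt by (intro power_decreasing) auto
  moreover have "1 - norm z ^ p \<le> norm (1 + z ^ p)"
    using norm_diff_ineq[of 1 "z ^ p"] by (simp add: norm_power)
  ultimately have "1 - norm z \<le> norm (1 + z ^ p)" by simp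
  then show ?thesis using nz assms by (simp add: norm_q powr_mono2')
qed

text \<open>The primitive of \<open>q\<close> normalised at 0. It is determined on
  \<open>\<Omega>\<close> only; the choice operator leaves its values on the slits
  arbitrary.\<close>

definition f :: "complex \<Rightarrow> complex" where
  "f = (SOME f. f 0 = 0 \<and> (\<forall>z\<in>\<Omega>. (f has_field_derivative q z) (at z)))"

lemma f_spec: "f 0 = 0 \<and> (\<forall>z\<in>\<Omega>. (f has_field_derivative q z) (at z))"
proof -
  obtain g where g: "\<forall>z\<in>\<Omega>. (g has_field_derivative q z) (at z)"
    using holomorphic_starlike_primitive[OF holomorphic_on_imp_continuous_on[OF holomorphic_q]
        starlike_\<Omega> open_\<Omega> finite.emptyI]
      holomorphic_on_imp_differentiable_at[OF holomorphic_q open_\<Omega>] by auto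
  have "\<exists>f. f 0 = 0 \<and> (\<forall>z\<in>\<Omega>. (f has_field_derivative q z) (at z))"
    by (rule exI[of _ "\<lambda>z. g z - g 0"]) (use g in \<open>auto intro!: derivative_eq_intros\<close>)
  then show ?thesis unfolding f_def by (rule someI_ex)
qed

lemma f_0 [simp]: "f 0 = 0"
  and f_deriv: "z \<in> \<Omega> \<Longrightarrow> (f has_field_derivative q z) (at z)"
  using f_spec by auto

lemma f_holomorphic: "S \<subseteq> \<Omega> \<Longrightarrow> f holomorphic_on S"
  unfolding holomorphic_on_def using f_deriv
  by (meson field_differentiable_at_within field_differentiable_def subsetD)

lemma f_cont: "S \<subseteq> \<Omega> \<Longrightarrow> continuous_on S f"
  by (rule holomorphic_on_imp_continuous_on[OF f_holomorphic])

text \<open>\<open>q\<close> depends on \<open>z ^ p\<close> alone, so both sides have the same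
  derivative on the connected set \<open>\<Omega>\<close> and the same value at 0. This is the
  rotational symmetry that reduces all edges of the polygon to the right one.\<close>

lemma f_mult_root:
  assumes "a ^ p = 1" "z \<in> \<Omega>" shows "f (a * z) = a * f z"
proof -
  define h where "h z = f (a * z) - a * f z" for z
  have qa: "q (a * w) = q w" for w using assms(1) by (simp add: q_def power_mult_distrib)
  have "(h has_field_derivative 0) (at w)" if "w \<in> \<Omega>" for w
  proof -
    have "((\<lambda>w. f (a * w)) has_field_derivative q (a * w) * a) (at w)"
      using that assms(1) mult_root_\<Omega>[of a w]
      by (intro DERIV_chain2[of f]) (auto intro!: f_deriv derivative_eq_intros)
    from DERIV_diff[OF this DERIV_cmult[OF f_deriv[OF that], of a]]
    show ?thesis unfolding h_def qa by simp
  qed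
  from has_field_derivative_0_imp_constant_on[OF this connected_\<Omega> open_\<Omega>]
  have "h z = h 0" using assms(2) zero_\<Omega> by (auto simp: constant_on_def)
  then show ?thesis by (simp add: h_def)
qed

lemma f_uminus: "z \<in> \<Omega> \<Longrightarrow> f (- z) = - f z"
  using f_mult_root[of "-1" z] p_even by simp

lemma f_cnj:
  assumes "z \<in> \<Omega>" shows "f (cnj z) = cnj (f z)"
proof -
  define h where "h z = (cnj \<circ> f \<circ> cnj) z - f z" for z
  have qc: "cnj (q (cnj w)) = q w" if "w \<in> \<Omega>" for w
  proof -
    have "cnj (Ln (1 + cnj w ^ p)) = Ln (1 + w ^ p)"
      using that cnj_Ln[of "1 + cnj w ^ p"] cnj_\<Omega>[of w] by (simp add: \<Omega>_def)
    then show ?thesis by (simp add: q_def exp_cnj)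
  qed
  have "(h has_field_derivative 0) (at w)" if "w \<in> \<Omega>" for w
  proof -
    have "((cnj \<circ> f \<circ> cnj) has_field_derivative cnj (q (cnj w))) (at w)"
      using that cnj_\<Omega>[of w] by (intro has_field_derivative_cnj_cnj f_deriv) auto
    from DERIV_diff[OF this f_deriv[OF that]]
    show ?thesis unfolding h_def qc[OF that] by simp
  qed
  from has_field_derivative_0_imp_constant_on[OF this connected_\<Omega> open_\<Omega>]
  have "h z = h 0" using assms zero_\<Omega> by (auto simp: constant_on_def)
  then have "cnj (f (cnj z)) = f z" by (simp add: h_def)
  then show ?thesis by (metis complex_cnj_cnj)
qed

text \<open>The Noshiro-Warschawski argument: by the mean value theorem on a segment, the real part
  of the difference quotient equals \<open>Re (q u)\<close> for some \<open>u\<close> between the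
  points, and this is positive.\<close>

lemma f_inj_on:
  assumes "convex S" "S \<subseteq> \<Omega>" shows "inj_on f S"
proof (rule inj_onI, rule ccontr)
  fix z w assume zw: "z \<in> S" "w \<in> S" "f z = f w" "z \<noteq> w"
  have seg: "closed_segment w z \<subseteq> \<Omega>"
    using zw assms closed_segment_subset[of w S z] by blast
  have "((\<lambda>x. f x / (z - w)) has_field_derivative q u / (z - w)) (at u)"
    if "u \<in> closed_segment w z" for u
    using that seg by (intro DERIV_cdivide f_deriv) auto
  from complex_mvt_line[OF this]
  obtain u where u: "u \<in> closed_segment w z"
    "Re (f z / (z - w)) - Re (f w / (z - w)) = Re (q u / (z - w) * (z - w))" by blast
  then have "Re (q u) = 0" using zw by simp
  then show False using Re_q_pos[of u] u seg by auto
qed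

lemma f_ray_deriv:
  assumes "of_real r * w \<in> \<Omega>"
  shows "((\<lambda>t. f (of_real t * w)) has_vector_derivative w * q (of_real r * w)) (at r)"
proof -
  have "((\<lambda>t. of_real t * w) has_vector_derivative w) (at r)"
    by (auto intro!: derivative_eq_intros)
  from field_vector_diff_chain_at[OF this f_deriv[OF assms]]
  show ?thesis by (simp add: o_def)
qed

section \<open>The sector around the positive real axis\<close>

text \<open>Since \<open>K p\<close> is the inradius, \<open>K p * T\<close> is half the length of
  an edge.\<close>

definition T :: real where
  "T = tan (pi / p)"

text \<open>The open wedge of half-angle \<open>pi / p\<close> around the positive axis, bounded by
  two neighbouring slit directions. This form shows it as an intersection of two half-planes, hence
  open and convex.\<close>

definition sector :: "complex set" where
  "sector = {z. \<bar>Im z\<bar> < T * Re z}"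

lemma angle: "0 < pi / p" "pi / p \<le> pi / 4" "pi / p < pi / 2"
proof -
  show "0 < pi / p" using p_gt by simp
  show "pi / p \<le> pi / 4" using p_ge by (intro divide_left_mono) auto
  then show "pi / p < pi / 2" using pi_gt_zero by linarith
qed

lemma T_pos: "T > 0"
  unfolding T_def using angle by (intro tan_gt_zero) auto

lemma abs_tan:
  assumes "\<bar>\<theta>\<bar> < pi / 2" shows "\<bar>tan \<theta>\<bar> = tan \<bar>\<theta>\<bar>"
  using assms tan_pos_pi2_le[of \<theta>] tan_pos_pi2_le[of "- \<theta>"] by (cases "\<theta> \<ge> 0") auto

lemma rcis_sector:
  assumes "r > 0" "\<bar>\<theta>\<bar> < pi / p" shows "rcis r \<theta> \<in> sector"
proof -
  have c: "cos \<theta> > 0" using assms angle by (intro cos_gt_zero_pi) linarith+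
  have "tan \<bar>\<theta>\<bar> < T"
    unfolding T_def using assms angle by (subst tan_monotone'[symmetric]) linarith+
  then have "\<bar>tan \<theta>\<bar> < T" using assms angle abs_tan[of \<theta>] by linarith
  then have "\<bar>sin \<theta>\<bar> < T * cos \<theta>"
    using c by (simp add: tan_def abs_divide pos_divide_less_eq)
  then show ?thesis using assms(1) by (simp add: sector_def abs_mult mult.left_commute)
qed

lemma sectorE:
  assumes "z \<in> sector"
  obtains r \<theta> where "r > 0" "\<bar>\<theta>\<bar> < pi / p" "z = rcis r \<theta>"
proof -
  have "0 < T * Re z" using assms by (simp add: sector_def)
  then have Rz: "Re z > 0" using T_pos by (simp add: zero_less_mult_iff)
  then have z0: "z \<noteq> 0" by auto
  define \<theta> where "\<theta> = Arg z"
  have z: "z = rcis (cmod z) \<theta>" by (simp add: \<theta>_def rcis_cmod_Arg)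
  have t: "\<bar>\<theta>\<bar> < pi / 2" using Re_Ln_pos_lt[OF z0] Rz unfolding \<theta>_def Arg_eq_Im_Ln[OF z0] by blast
  then have c: "cos \<theta> > 0" by (intro cos_gt_zero_pi) linarith+
  have "\<bar>cmod z * sin \<theta>\<bar> < T * (cmod z * cos \<theta>)"
    using assms z unfolding sector_def by (metis Im_rcis Re_rcis mem_Collect_eq)
  then have "cmod z * \<bar>sin \<theta>\<bar> < cmod z * (T * cos \<theta>)" by (simp add: abs_mult mult.left_commute)
  then have "\<bar>sin \<theta>\<bar> < T * cos \<theta>" using z0 by (simp add: mult_less_cancel_left_pos)
  then have "\<bar>tan \<theta>\<bar> < T" using c by (simp add: tan_def abs_divide pos_divide_less_eq)
  then have "tan \<bar>\<theta>\<bar> < T" using abs_tan[OF t] by simp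
  then have "\<bar>\<theta>\<bar> < pi / p"
    unfolding T_def using t angle by (subst tan_monotone') linarith+
  then show ?thesis using that[of "cmod z" \<theta>] z z0 by simp
qed

lemma sector_halfspaces:
  "sector = {z. Complex (-T) 1 \<bullet> z < 0} \<inter> {z. Complex (-T) (-1) \<bullet> z < 0}"
  by (auto simp: sector_def inner_complex_def)

lemma convex_sector: "convex sector"
  unfolding sector_halfspaces by (rule convex_Int[OF convex_halfspace_lt convex_halfspace_lt])

lemma open_sector: "open sector"
  unfolding sector_halfspaces by (rule open_Int[OF open_halfspace_lt open_halfspace_lt])

text \<open>In the wedge \<open>p * \<theta>\<close> stays strictly between \<open>- pi\<close> and
  \<open>pi\<close>, so \<open>z ^ p\<close> is real only for \<open>\<theta> = 0\<close>, where it
  is positive.\<close>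

lemma sector_\<Omega>: "sector \<subseteq> \<Omega>"
proof
  fix z assume "z \<in> sector"
  then obtain r \<theta> where r: "r > 0" "\<bar>\<theta>\<bar> < pi / p" and z: "z = rcis r \<theta>" by (rule sectorE)
  show "z \<in> \<Omega>"
  proof (rule ccontr)
    assume "z \<notin> \<Omega>"
    then have *: "1 + r ^ p * cos (p * \<theta>) \<le> 0" "r ^ p * sin (p * \<theta>) = 0"
      by (auto simp: \<Omega>_def complex_nonpos_Reals_iff z DeMoivre2)
    have "\<bar>p * \<theta>\<bar> < pi" using r p_gt by (simp add: abs_mult field_simps)
    then have "sin (p * \<theta>) = 0 \<longleftrightarrow> p * \<theta> = 0"
      using sin_eq_0_pi[of "p * \<theta>"] by (metis abs_less_iff minus_less_iff sin_zero)
    moreover have "r ^ p > 0" using r(1) by simp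
    ultimately have "\<theta> = 0" using *(2) p_gt r(1) by simp
    then show False using *(1) \<open>r ^ p > 0\<close> by simp
  qed
qed

lemma q_of_real:
  assumes "x \<ge> 0" shows "q (of_real x) = of_real (1 / (1 + x ^ p) powr (2 / p))"
proof -
  have "1 + x ^ p > 0" using assms by (simp add: add_pos_nonneg)
  moreover have "q (of_real x) = exp (- (2 / of_nat p) * Ln (of_real (1 + x ^ p)))"
    by (simp add: q_def)
  ultimately have "q (of_real x) = exp (of_real (- (2 / p) * ln (1 + x ^ p)))"
    by (subst (asm) Ln_of_real) auto
  then show ?thesis using \<open>1 + x ^ p > 0\<close>
    by (simp only: exp_of_real) (simp add: powr_def exp_minus field_simps)
qed

lemma f_1: "f 1 = of_real (K p)"
proof -
  have "((\<lambda>x. of_real (1 / (1 + x ^ p) powr (2 / p))) has_integral f 1 - f 0) {0..1}"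
  proof -
    have "((\<lambda>t. f (of_real t)) has_vector_derivative of_real (1 / (1 + x ^ p) powr (2 / p))) (at x within {0..1})"
      if "x \<in> {0..1}" for x
    proof -
      have "1 \<in> sector" using T_pos by (simp add: sector_def)
      then have "of_real x * 1 \<in> \<Omega>" using that sector_\<Omega> scale_\<Omega> by fastforce
      from f_ray_deriv[OF this] show ?thesis
        using that by (simp add: q_of_real has_vector_derivative_at_within)
    qed
    from fundamental_theorem_of_calculus[OF _ this] show ?thesis by simp
  qed
  from has_integral_linear[OF this bounded_linear_Re]
  have "((\<lambda>x. 1 / (1 + x ^ p) powr (2 / p)) has_integral Re (f 1)) {0..1}"
    by (simp add: o_def)
  then have "Re (f 1) = K p" unfolding K_def by (simp add: integral_unique)
  moreover have "Im (f 1) = 0"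
  proof -
    have "1 \<in> \<Omega>" using T_pos sector_\<Omega> by (auto simp: sector_def)
    then have "cnj (f 1) = f 1" using f_cnj[of 1] by simp
    then show ?thesis by (metis Reals_cnj_iff complex_is_Real_iff)
  qed
  ultimately show ?thesis by (simp add: complex_eq_iff)
qed

lemma cis_\<Omega>: "\<bar>\<theta>\<bar> < pi / p \<Longrightarrow> cis \<theta> \<in> \<Omega>"
  using rcis_sector[of 1 \<theta>] sector_\<Omega> by (auto simp: rcis_def)

text \<open>On the unit arc the argument of \<open>f'\<close> is \<open>-\<theta>\<close>, so \<open>f\<close> moves vertically.\<close>

lemma Re_f_cis:
  assumes "\<bar>\<theta>\<bar> < pi / p" shows "Re (f (cis \<theta>)) = K p"
proof -
  define I where "I = {-(pi/p)<..<pi/p}"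
  have "((\<lambda>\<theta>. Re (f (cis \<theta>))) has_field_derivative 0) (at x within I)" if "x \<in> I" for x
  proof -
    have x: "\<bar>x\<bar> < pi / p" using that by (auto simp: I_def)
    have px: "\<bar>p * x / 2\<bar> < pi / 2" using x p_gt by (simp add: abs_mult field_simps)
    then have c: "cos (p * x / 2) > 0" by (intro cos_gt_zero_pi) linarith+
    have ReIm: "Re (cis x ^ p) = cos (p * x)" "Im (cis x ^ p) = sin (p * x)"
      by (simp_all only: Complex.DeMoivre cis.sel)
    \<comment> \<open>The half-angle identity gives the polar form of \<open>1 + cis x ^ p\<close>,
      because the cosine is positive on the arc; the principal logarithm is then explicit. The
      exponent \<open>- 2 / p\<close> turns the argument \<open>p * x / 2\<close> into
      \<open>- x\<close>, which cancels the factor \<open>cis x\<close> of the velocity.\<close>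
    have "1 + cis x ^ p = rcis (2 * cos (p * x / 2)) (p * x / 2)"
      using cos_double_cos[of "p * x / 2"] sin_double[of "p * x / 2"]
      by (simp add: complex_eq_iff ReIm power2_eq_square)
    moreover from this have "Ln (1 + cis x ^ p) = Complex (ln (2 * cos (p * x / 2))) (p * x / 2)"
      using px c by (simp only:) (rule Ln_rcis, auto)
    ultimately have "q (cis x) = of_real (exp (- (2 / p) * ln (2 * cos (p * x / 2)))) * cis (- x)"
      using c p_gt q_eq_polar[of "cis x"] by (simp add: norm_mult rcis_def)
    then have q: "\<i> * cis x * q (cis x) = \<i> * of_real (exp (- (2 / p) * ln (2 * cos (p * x / 2))))"
      by (simp add: cis_mult)
    have "(cis has_vector_derivative \<i> * cis x) (at x)"
      unfolding has_vector_derivative_def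
      by (rule has_derivative_eq_rhs, rule has_derivative_cis, rule has_derivative_ident)
         (auto simp: fun_eq_iff scaleR_conv_of_real)
    from field_vector_diff_chain_at[OF this f_deriv[OF cis_\<Omega>[OF x]]]
    have "((\<lambda>\<theta>. f (cis \<theta>)) has_vector_derivative \<i> * cis x * q (cis x)) (at x)"
      by (simp add: o_def)
    then have "((\<lambda>\<theta>. Re (f (cis \<theta>))) has_vector_derivative Re (\<i> * cis x * q (cis x))) (at x)"
      by (rule bounded_linear.has_vector_derivative[OF bounded_linear_Re])
    then have "((\<lambda>\<theta>. Re (f (cis \<theta>))) has_vector_derivative 0) (at x)" unfolding q by simp
    then show ?thesis
      by (simp add: has_real_derivative_iff_has_vector_derivative has_vector_derivative_at_within)
  qed
  from has_field_derivative_zero_constant[OF _ this]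
  obtain k where k: "\<forall>x\<in>I. Re (f (cis x)) = k" by (auto simp: I_def)
  have "\<theta> \<in> I" "0 \<in> I"
    unfolding I_def greaterThanLessThan_iff using assms angle by linarith+
  then have "Re (f (cis \<theta>)) = k" "Re (f (cis 0)) = k" using k \<open>\<theta> \<in> I\<close> \<open>0 \<in> I\<close> by auto
  then show ?thesis by (simp add: f_1)
qed

text \<open>The argument of the product is \<open>\<theta> - (2 / p) * \<psi>\<close>. As
  \<open>Im (1 + w ^ p)\<close> has the sign of \<open>\<theta>\<close>, the angles
  \<open>\<theta>\<close> and \<open>\<psi>\<close> have equal signs; both terms are below
  \<open>pi / 2\<close> in modulus, and hence so is their difference.\<close>

lemma Re_mult_q_pos:
  assumes "w \<in> sector" shows "Re (w * q w) > 0"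
proof -
  obtain r \<theta> where r: "r > 0" "\<bar>\<theta>\<bar> < pi / p" and w: "w = rcis r \<theta>"
    using assms by (rule sectorE)
  define \<psi> where "\<psi> = Im (Ln (1 + w ^ p))"
  have \<Omega>: "1 + w ^ p \<notin> \<real>\<^sub>\<le>\<^sub>0" using assms sector_\<Omega> by (auto simp: \<Omega>_def)
  then have nz: "1 + w ^ p \<noteq> 0" by auto
  have \<psi>: "-pi < \<psi>" "\<psi> < pi"
    using Im_Ln_less_pi[OF \<Omega>] mpi_less_Im_Ln[OF nz] by (auto simp: \<psi>_def)
  have im: "Im (1 + w ^ p) = r ^ p * sin (p * \<theta>)" by (simp add: w DeMoivre2)
  have p\<theta>: "\<bar>p * \<theta>\<bar> < pi" using r p_gt by (simp add: abs_mult field_simps)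
  have "\<bar>\<theta> - (2 / p) * \<psi>\<bar> < pi / 2"
  proof -
    have b: "\<bar>(2 / p) * \<psi>\<bar> < pi / 2"
    proof -
      have "\<bar>(2 / p) * \<psi>\<bar> = (2 / p) * \<bar>\<psi>\<bar>" by (simp add: abs_mult)
      also have "\<dots> < (2 / p) * pi" using \<psi> p_gt by (intro mult_strict_left_mono) auto
      also have "\<dots> \<le> pi / 2" using p_ge by (simp add: field_simps)
      finally show ?thesis .
    qed
    consider "\<theta> > 0" | "\<theta> = 0" | "\<theta> < 0" by linarith
    then show ?thesis
    proof cases
      case 1
      then have "sin (p * \<theta>) > 0" using p\<theta> p_gt by (intro sin_gt_zero) auto
      then have "\<psi> > 0" using r im Im_Ln_pos_lt[OF nz] by (simp add: \<psi>_def)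
      then have "(2 / p) * \<psi> > 0" using p_gt by simp
      then show ?thesis using b 1 r angle by (simp only: abs_less_iff) linarith
    next
      case 2
      then have "1 + w ^ p = of_real (1 + r ^ p)" by (simp add: w DeMoivre2 rcis_def)
      moreover have "1 + r ^ p > 0" using r by (simp add: add_pos_pos)
      ultimately have "\<psi> = 0" unfolding \<psi>_def by (simp only: Ln_of_real Im_complex_of_real)
      then show ?thesis using 2 by simp
    next
      case 3
      then have "sin (- (p * \<theta>)) > 0"
        using p\<theta> p_gt by (intro sin_gt_zero) (auto simp: mult_less_0_iff)
      then have "Im (1 + w ^ p) < 0" using r im by (simp add: mult_less_0_iff zero_less_mult_iff)
      then have "\<psi> < 0" using Im_Ln_pos_le[OF nz] \<psi> unfolding \<psi>_def by linarith
      then have "(2 / p) * \<psi> < 0" using p_gt by (simp add: mult_less_0_iff divide_less_0_iff)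
      then show ?thesis using b 3 r angle by (simp only: abs_less_iff) linarith
    qed
  qed
  then have c: "cos (\<theta> - (2 / p) * \<psi>) > 0" by (intro cos_gt_zero_pi) linarith+
  obtain E where E: "E > 0" "q w = of_real E * cis (- (2 / p) * \<psi>)"
    using q_eq_polar[OF nz] unfolding \<psi>_def by (metis exp_gt_zero)
  have "w * q w = of_real (r * E) * (cis \<theta> * cis (- (2 / p) * \<psi>))"
    unfolding E(2) by (simp add: w rcis_def)
  then have wq: "w * q w = of_real (r * E) * cis (\<theta> - (2 / p) * \<psi>)"
    by (simp only: cis_mult) simp
  show ?thesis unfolding wq using r E(1) c by simp
qed

lemma Re_f_ray_mono:
  assumes "w \<in> sector" "0 \<le> a" "a < b"
  shows "Re (f (of_real a * w)) < Re (f (of_real b * w))"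
proof -
  have sec: "of_real t * w \<in> sector" if "t > 0" for t
    using assms(1) that by (simp add: sector_def abs_mult mult.left_commute)
  have \<Omega>: "of_real t * w \<in> \<Omega>" if "t \<ge> 0" for t
    using sec[of t] sector_\<Omega> zero_\<Omega> that by (cases "t = 0") auto
  have D: "((\<lambda>t. Re (f (of_real t * w))) has_real_derivative Re (w * q (of_real t * w))) (at t)"
    if "t \<ge> 0" for t
    unfolding has_real_derivative_iff_has_vector_derivative
    by (rule bounded_linear.has_vector_derivative[OF bounded_linear_Re f_ray_deriv[OF \<Omega>[OF that]]])
  show ?thesis
  proof (rule DERIV_pos_imp_increasing_open[OF assms(3)])
    fix t assume t: "a < t" "t < b"
    define X where "X = w * q (of_real t * w)"
    have "Re (of_real t * X) > 0"
      using Re_mult_q_pos[OF sec[of t]] t assms by (simp add: X_def mult.assoc)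
    then have "Re X > 0"
      using t assms by (simp add: zero_less_mult_iff)
    then have "Re (w * q (of_real t * w)) > 0" by (simp only: X_def)
    then show "\<exists>y. ((\<lambda>t. Re (f (of_real t * w))) has_real_derivative y) (at t) \<and> 0 < y"
      using D[of t] t assms by auto
  next
    show "continuous_on {a..b} (\<lambda>t. Re (f (of_real t * w)))"
      using assms(2) by (intro DERIV_continuous_on[where D="\<lambda>t. Re (w * q (of_real t * w))"])
        (simp add: has_field_derivative_at_within[OF D] del: times_complex.sel)
  qed
qed

lemma K_pos: "K p > 0"
  using Re_f_ray_mono[of 1 0 1] T_pos by (simp add: sector_def f_1)

text \<open>On each ray of the sector \<open>Re f\<close> increases and has the value
  \<open>K p\<close> at the unit circle, so points on or beyond the circle have
  \<open>Re f \<ge> K p\<close>. This is what makes the disc and sector inverses coincide left of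
  the edge.\<close>

lemma norm_lt_1_if_sector:
  assumes "w \<in> sector" "Re (f w) < K p" shows "norm w < 1"
proof (rule ccontr)
  assume n: "\<not> norm w < 1"
  obtain r \<theta> where r: "r > 0" "\<bar>\<theta>\<bar> < pi / p" and w: "w = rcis r \<theta>"
    using assms(1) by (rule sectorE)
  have c: "cis \<theta> \<in> sector" using rcis_sector[of 1 \<theta>] r by (simp add: rcis_def)
  have "r \<ge> 1" using n r by (simp add: w)
  then have "Re (f (of_real 1 * cis \<theta>)) \<le> Re (f (of_real r * cis \<theta>))"
    using Re_f_ray_mono[OF c, of 1 r] by (cases "r = 1") auto
  then show False using assms(2) Re_f_cis[OF r(2)] by (simp add: w rcis_def)
qed

section \<open>The image of the disc and the polygon\<close>

definition \<beta> :: real where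
  "\<beta> = 1 - 2 / p"

text \<open>The integral of \<open>(1 - t) powr (- (2 / p))\<close> over
  \<open>{r..1}\<close>.\<close>

definition \<delta> :: "real \<Rightarrow> real" where
  "\<delta> r = (1 - r) powr \<beta> / \<beta>"

lemma \<beta>_pos: "\<beta> > 0"
  using p_gt by (simp add: \<beta>_def)

lemma \<delta>_small:
  assumes "e > 0" obtains r where "0 < r" "r < 1" "\<delta> r \<le> e"
proof -
  \<comment> \<open>The second entry solves \<open>x powr \<beta> / \<beta> = e\<close>; the cap 1/2
    keeps the radius \<open>1 - x\<close> strictly between 0 and 1.\<close>
  define x where "x = min (1/2) ((e * \<beta>) powr (1 / \<beta>))"
  have x: "0 < x" "x < 1" using assms \<beta>_pos by (auto simp: x_def)
  have "x powr \<beta> \<le> ((e * \<beta>) powr (1 / \<beta>)) powr \<beta>"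
    using x \<beta>_pos by (intro powr_mono2) (auto simp: x_def)
  also have "\<dots> = e * \<beta>" using assms \<beta>_pos by (simp add: powr_powr)
  finally have "\<delta> (1 - x) \<le> e" using \<beta>_pos by (simp add: \<delta>_def field_simps)
  then show ?thesis using that[of "1 - x"] x by simp
qed

text \<open>The estimate \<open>\<bar>f'(t w)\<bar> \<le> (1 - t) powr (- 2 / p)\<close> is integrable up to the unit circle because \<open>p > 2\<close>.\<close>

lemma f_radial_bound:
  assumes "w \<in> \<Omega>" "norm w = 1" "0 \<le> r" "r < 1"
  shows "norm (f w - f (of_real r * w)) \<le> \<delta> r"
proof -
  have \<Omega>: "of_real t * w \<in> \<Omega>" if "0 \<le> t" "t \<le> 1" for t
    using scale_\<Omega>[OF assms(1) that] .
  \<comment> \<open>\<open>- \<delta>\<close> is an antiderivative of the bound on the speed. At the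
    end \<open>t = 1\<close>, where that bound degenerates, only continuity of both functions is
    required.\<close>
  have "norm (f (of_real 1 * w) - f (of_real r * w)) \<le> (- \<delta> 1) - (- \<delta> r)"
  proof (rule differentiable_bound_general[OF assms(4)])
    show "continuous_on {r..1} (\<lambda>t. f (of_real t * w))"
      using assms(3) has_vector_derivative_continuous[OF f_ray_deriv[OF \<Omega>]]
      by (intro continuous_at_imp_continuous_on) auto
    show "continuous_on {r..1} (\<lambda>t. - \<delta> t)"
      unfolding \<delta>_def using \<beta>_pos
      by (intro continuous_intros continuous_on_powr') auto
    fix t assume t: "r < t" "t < 1"
    show "((\<lambda>t. f (of_real t * w)) has_vector_derivative w * q (of_real t * w)) (at t)"
      using t assms(3) by (intro f_ray_deriv \<Omega>) auto
    have "((\<lambda>t. 1 - t) has_real_derivative -1) (at t)"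
      by (auto intro!: derivative_eq_intros)
    from DERIV_chain2[OF has_real_derivative_powr[of "1 - t" \<beta>] this]
    have "((\<lambda>t. (1 - t) powr \<beta>) has_real_derivative \<beta> * (1 - t) powr (\<beta> - 1) * -1) (at t)"
      using t by simp
    from DERIV_cmult[OF this, of "- 1 / \<beta>"]
    have "((\<lambda>t. - \<delta> t) has_real_derivative (1 - t) powr (\<beta> - 1)) (at t)"
      using \<beta>_pos by (simp add: \<delta>_def)
    then have "((\<lambda>t. - \<delta> t) has_real_derivative (1 - t) powr (- (2 / p))) (at t)"
      by (simp add: \<beta>_def)
    then show "((\<lambda>t. - \<delta> t) has_vector_derivative (1 - t) powr (- (2 / p))) (at t)"
      by (simp add: has_real_derivative_iff_has_vector_derivative)
    show "norm (w * q (of_real t * w)) \<le> (1 - t) powr (- (2 / p))"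
      using norm_q_le[of "of_real t * w"] t assms by (simp add: norm_mult)
  qed
  then show ?thesis using \<beta>_pos by (simp add: \<delta>_def)
qed

lemma continuous_f_rcis:
  assumes "0 \<le> r" "r < 1" shows "continuous_on A (\<lambda>\<theta>. f (rcis r \<theta>))"
proof (rule continuous_on_compose2[OF f_cont[OF ball_\<Omega>]])
  show "continuous_on A (\<lambda>\<theta>. rcis r \<theta>)"
    unfolding rcis_def by (intro continuous_intros)
qed (use assms in auto)

lemma cis_rcis_bound:
  assumes "\<bar>\<theta>\<bar> < pi / p" "0 \<le> r" "r < 1"
  shows "norm (f (cis \<theta>) - f (rcis r \<theta>)) \<le> \<delta> r"
  using f_radial_bound[OF cis_\<Omega>[OF assms(1)]] assms by (simp add: rcis_def)

lemma closure_arc: "closure {-(pi/p)<..<pi/p} = {-(pi/p)..pi/p}"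
  using angle by (intro closure_greaterThanLessThan) linarith

text \<open>On the open arc the boundary value has real part \<open>K p\<close>, and the radial
  bound costs at most \<open>\<delta> r\<close>. The directions \<open>\<theta> = pi / p\<close> and
  \<open>\<theta> = - pi / p\<close>, whose radii end at singular points, follow by continuity in
  \<open>\<theta>\<close> at the fixed radius \<open>r < 1\<close>.\<close>

lemma Re_f_sector_ge:
  assumes "\<bar>\<theta>\<bar> \<le> pi / p" "0 \<le> r" "r < 1"
  shows "Re (f (rcis r \<theta>)) \<ge> K p - \<delta> r"
proof (rule continuous_ge_on_closure[where f="\<lambda>\<theta>. Re (f (rcis r \<theta>))"])
  show "continuous_on (closure {-(pi/p)<..<pi/p}) (\<lambda>\<theta>. Re (f (rcis r \<theta>)))"
    using continuous_f_rcis[OF assms(2,3)] by (intro continuous_intros)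
  show "\<theta> \<in> closure {-(pi/p)<..<pi/p}" using assms unfolding closure_arc by auto
  fix x assume "x \<in> {-(pi/p)<..<pi/p}"
  then have x: "\<bar>x\<bar> < pi / p" by auto
  show "K p - \<delta> r \<le> Re (f (rcis r x))"
    using cis_rcis_bound[OF x assms(2,3)] Re_f_cis[OF x]
      complex_Re_le_cmod[of "f (cis x) - f (rcis r x)"] by simp
qed

definition \<omega> :: "int \<Rightarrow> complex" where
  "\<omega> k = cis (- (2 * pi * of_int k / p))"

lemma \<omega>_power: "\<omega> k ^ p = 1"
proof -
  have "\<omega> k ^ p = cis (2 * pi * of_int (- k))"
    using p_gt unfolding \<omega>_def Complex.DeMoivre by (simp add: field_simps)
  also have "\<dots> = 1" by (rule cis_multiple_2pi) auto
  finally show ?thesis .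
qed

text \<open>Rounding \<open>Arg w\<close> in units of \<open>2 * pi / p\<close> selects the nearest
  edge direction; the rotation \<open>\<omega> k\<close> brings \<open>w\<close> into the closed
  wedge, where \<open>Re_f_sector_ge\<close> applies. Confining \<open>k\<close> to a finite range
  later allows a maximum and an open finite intersection over the edges.\<close>

lemma f_near_edge:
  assumes "norm w < 1"
  obtains k where "k \<in> {- int p..int p}" "Re (\<omega> k * f w) \<ge> K p - \<delta> (norm w)"
proof -
  define \<phi> where "\<phi> = Arg w"
  have w: "w = rcis (norm w) \<phi>" by (simp add: \<phi>_def rcis_cmod_Arg)
  have \<phi>: "-pi < \<phi>" "\<phi> \<le> pi" using Arg_bounded[of w] by (auto simp: \<phi>_def)
  define x where "x = \<phi> * p / (2 * pi)"
  define k where "k = round x"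
  have "\<bar>x\<bar> = \<bar>\<phi>\<bar> * (p / (2 * pi))" by (simp add: x_def abs_mult)
  also have "\<dots> \<le> pi * (p / (2 * pi))" using \<phi> by (intro mult_right_mono) auto
  finally have x: "\<bar>x\<bar> \<le> p / 2" by simp
  have kx: "\<bar>of_int k - x\<bar> \<le> 1 / 2" unfolding k_def by (rule of_int_round_abs_le)
  then have "\<bar>of_int k\<bar> \<le> real p" using x p_gt by linarith
  then have "\<bar>k\<bar> \<le> int p" by linarith
  then have k: "k \<in> {- int p..int p}" by auto
  define \<theta> where "\<theta> = \<phi> - 2 * pi * of_int k / p"
  have "\<theta> = (2 * pi / p) * (x - of_int k)" using p_gt by (simp add: \<theta>_def x_def field_simps)
  then have "\<bar>\<theta>\<bar> = (2 * pi / p) * \<bar>of_int k - x\<bar>" by (simp add: abs_mult abs_minus_commute)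
  also have "\<dots> \<le> (2 * pi / p) * (1 / 2)" using kx by (intro mult_left_mono) auto
  finally have \<theta>: "\<bar>\<theta>\<bar> \<le> pi / p" by simp
  have "\<omega> k * w = rcis (norm w) \<theta>"
    by (subst w) (simp add: \<omega>_def rcis_def \<theta>_def cis_mult mult.left_commute)
  moreover have "f (\<omega> k * w) = \<omega> k * f w"
    using assms ball_\<Omega> by (intro f_mult_root \<omega>_power) auto
  ultimately show ?thesis using that[OF k] Re_f_sector_ge[OF \<theta> _ assms] by simp
qed

section \<open>Supporting half-planes, vertices and the inscribed rectangle of the polygon\<close>

lemma cos_odd_multiple_le: "cos ((2 * of_int m + 1) * pi / p) \<le> cos (pi / p)"
proof -
  \<comment> \<open>Reduction modulo \<open>p\<close> shifts the angle by a multiple of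
    \<open>2 * pi\<close> into the range from \<open>pi / p\<close> to
    \<open>2 * pi - pi / p\<close>, on which the cosine is largest at the end points.\<close>
  define j where "j = m mod int p"
  have j: "0 \<le> j" "j < int p" using p_gt by (auto simp: j_def)
  have "real_of_int m = of_int (j + int p * (m div int p))" by (simp add: j_def)
  then have m: "real_of_int m = of_int j + p * of_int (m div int p)" by simp
  define x where "x = (2 * of_int j + 1) * pi / p"
  have "(2 * of_int m + 1) * pi / p = x + 2 * pi * of_int (m div int p)"
    unfolding m x_def using p_gt by (simp add: field_simps)
  then have cx: "cos ((2 * of_int m + 1) * pi / p) = cos x"
    by (simp only: cos_add cos_int_2pin sin_int_2pin mult_1_right mult_zero_right diff_zero)
  have "real_of_int j + 1 \<le> p" using j by linarith
  then have "(2 * of_int j + 1) * (pi / p) \<le> (2 * p - 1) * (pi / p)" by (intro mult_right_mono) auto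
  also have "\<dots> = 2 * pi - pi / p" using p_gt by (simp add: field_simps)
  finally have x: "pi / p \<le> x" "x \<le> 2 * pi - pi / p"
    using j p_gt by (auto simp: x_def field_simps)
  show ?thesis
  proof (cases "x \<le> pi")
    case True
    then show ?thesis unfolding cx using x angle by (intro cos_monotone_0_pi_le) auto
  next
    case False
    have "cos x = cos (2 * pi - x)" by simp
    also have "\<dots> \<le> cos (pi / p)" using x angle False by (intro cos_monotone_0_pi_le) auto
    finally show ?thesis unfolding cx .
  qed
qed

text \<open>A rotated vertex lies at an odd multiple of \<open>pi / p\<close> on the circumscribed
  circle, so its real part is at most \<open>K p\<close>; the hull inherits this, and passing to the
  interior makes it strict.\<close>

lemma open_pgon_halfplane:
  assumes "z \<in> open_pgon p" shows "Re (\<omega> k * z) < K p"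
proof -
  have c: "cos (pi / p) > 0" using angle by (intro cos_gt_zero_pi) linarith+
  have inner: "cnj (\<omega> k) \<bullet> w = Re (\<omega> k * w)" for w by (simp add: inner_complex_def)
  have "pgon_vertex p ` {0..<int p} \<subseteq> {w. cnj (\<omega> k) \<bullet> w \<le> K p}"
  proof (clarsimp simp: inner simp del: times_complex.sel cnj.sel)
    fix j
    have "- (2 * pi * of_int k / p) + (2 * of_int j + 1) * pi / p = (2 * of_int (j - k) + 1) * pi / p"
      using p_gt by (simp add: diff_divide_distrib add_divide_distrib algebra_simps)
    then have "cis (- (2 * pi * of_int k / p)) * cis ((2 * of_int j + 1) * pi / p)
        = cis ((2 * of_int (j - k) + 1) * pi / p)"
      by (simp only: cis_mult)
    then have "\<omega> k * pgon_vertex p j = of_real (K p / cos (pi / p)) * cis ((2 * of_int (j - k) + 1) * pi / p)"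
      unfolding pgon_vertex_def \<omega>_def by (metis mult.left_commute)
    then have "Re (\<omega> k * pgon_vertex p j) = K p / cos (pi / p) * cos ((2 * of_int (j - k) + 1) * pi / p)"
      by simp
    also have "\<dots> \<le> K p / cos (pi / p) * cos (pi / p)"
      using K_pos c by (intro mult_left_mono cos_odd_multiple_le) auto
    finally show "Re (\<omega> k * pgon_vertex p j) \<le> K p" using c by simp
  qed
  then have "convex hull (pgon_vertex p ` {0..<int p}) \<subseteq> {w. cnj (\<omega> k) \<bullet> w \<le> K p}"
    by (intro hull_minimal convex_halfspace_le)
  then have "open_pgon p \<subseteq> interior {w. cnj (\<omega> k) \<bullet> w \<le> K p}"
    unfolding open_pgon_def by (rule interior_mono)
  also have "\<dots> = {w. cnj (\<omega> k) \<bullet> w < K p}"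
    by (rule interior_halfspace_le) (simp add: \<omega>_def)
  finally show ?thesis using assms inner by auto
qed

lemma vertex_0: "pgon_vertex p 0 = Complex (K p) (K p * T)"
  and vertex_minus_1: "pgon_vertex p (- 1) = Complex (K p) (- (K p * T))"
proof -
  have "cos (pi / p) > 0" using angle by (intro cos_gt_zero_pi) linarith+
  then show "pgon_vertex p 0 = Complex (K p) (K p * T)"
    "pgon_vertex p (- 1) = Complex (K p) (- (K p * T))"
    by (auto simp: pgon_vertex_def T_def tan_def complex_eq_iff)
qed

lemma vertex_mod: "pgon_vertex p (j + int p) = pgon_vertex p j"
proof -
  have "(2 * real_of_int (j + int p) + 1) * pi / p = (2 * of_int j + 1) * pi / p + 2 * pi"
    using p_gt by (simp add: field_simps)
  then have "cis ((2 * real_of_int (j + int p) + 1) * pi / p) = cis ((2 * of_int j + 1) * pi / p)"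
    by (simp only: cis_mult[symmetric]) simp
  then show ?thesis unfolding pgon_vertex_def by simp
qed

lemma vertex_opposite: "pgon_vertex p (j + int (p div 2)) = - pgon_vertex p j"
proof -
  have "real (p div 2) = p / 2" using p_even by (simp add: real_of_nat_div)
  then have "(2 * real_of_int (j + int (p div 2)) + 1) * pi / p = (2 * of_int j + 1) * pi / p + pi"
    using p_gt by (simp add: field_simps)
  then have "cis ((2 * real_of_int (j + int (p div 2)) + 1) * pi / p) = - cis ((2 * of_int j + 1) * pi / p)"
    by (simp only: cis_mult[symmetric]) simp
  then show ?thesis unfolding pgon_vertex_def by simp
qed

text \<open>For even \<open>p\<close> the right edge has an opposite parallel edge, and their four
  end points span this rectangle: convex combinations are taken first along the two edges, then
  between them.\<close>

lemma rectangle_open_pgon: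
  assumes "\<bar>Re z\<bar> < K p" "\<bar>Im z\<bar> < K p * T" shows "z \<in> open_pgon p"
proof -
  define H where "H = convex hull (pgon_vertex p ` {0..<int p})"
  define R where "R = {z. \<bar>Re z\<bar> < K p \<and> \<bar>Im z\<bar> < K p * T}"
  have H: "convex H" by (simp add: H_def)
  have vH: "pgon_vertex p j \<in> H" if "j \<in> {0..<int p}" for j
    using that by (auto simp: H_def intro!: hull_inc)
  have neg: "- Complex a b = Complex (- a) (- b)" for a b by (simp add: complex_eq_iff)
  have v: "Complex (K p) (K p * T) \<in> H" "Complex (K p) (- (K p * T)) \<in> H"
    "Complex (- K p) (- (K p * T)) \<in> H" "Complex (- K p) (K p * T) \<in> H"
  proof -
    show "Complex (K p) (K p * T) \<in> H" using vH[of 0] p_gt by (simp add: vertex_0)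
    have "pgon_vertex p (- 1 + int p) \<in> H" using vH p_gt by auto
    then show "Complex (K p) (- (K p * T)) \<in> H" by (simp only: vertex_mod vertex_minus_1)
    have "pgon_vertex p (0 + int (p div 2)) \<in> H" using vH p_gt by auto
    then show "Complex (- K p) (- (K p * T)) \<in> H" unfolding vertex_opposite vertex_0 neg .
    have "pgon_vertex p (- 1 + int (p div 2)) \<in> H" using p_gt by (intro vH) auto
    then show "Complex (- K p) (K p * T) \<in> H" unfolding vertex_opposite vertex_minus_1 neg by simp
  qed
  have "R \<subseteq> H"
  proof
    fix w assume w: "w \<in> R"
    obtain C where C: "C = K p * T" "C > 0" using K_pos T_pos by simp
    define u where "u = (Im w + C) / (2 * C)"
    define u' where "u' = (Re w + K p) / (2 * K p)"
    have w: "\<bar>Re w\<bar> < K p" "\<bar>Im w\<bar> < C" using w by (auto simp: R_def C)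
    have u: "0 \<le> u" "u \<le> 1" "0 \<le> u'" "u' \<le> 1"
      using w C(2) K_pos by (auto simp: u_def u'_def divide_simps)
    have eq: "(2 * u - 1) * C = Im w" "(2 * u' - 1) * K p = Re w"
      using C(2) K_pos by (auto simp: u_def u'_def field_simps)
    have "(1 - u) *\<^sub>R Complex a (- (K p * T)) + u *\<^sub>R Complex a (K p * T) = Complex a (Im w)" for a
      unfolding C(1)[symmetric] using eq(1) by (simp add: complex_eq_iff algebra_simps)
    then have *: "Complex (- K p) (Im w) \<in> H" "Complex (K p) (Im w) \<in> H"
      using convexD_alt[OF H v(3,4) u(1,2)] convexD_alt[OF H v(2,1) u(1,2)] by simp_all
    have "(1 - u') *\<^sub>R Complex (- K p) (Im w) + u' *\<^sub>R Complex (K p) (Im w) = w"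
      using eq(2) by (simp add: complex_eq_iff algebra_simps)
    then show "w \<in> H" using convexD_alt[OF H * u(3,4)] by simp
  qed
  moreover have "open R"
    unfolding R_def by (intro open_Collect_conj open_Collect_less continuous_intros)
  ultimately have "R \<subseteq> open_pgon p"
    unfolding open_pgon_def H_def by (rule interior_maximal)
  then show ?thesis using assms by (auto simp: R_def)
qed

lemma zero_open_pgon: "0 \<in> open_pgon p"
  using K_pos T_pos by (intro rectangle_open_pgon) auto

lemma right_open_edge_eq: "right_open_edge p = {z. Re z = K p \<and> \<bar>Im z\<bar> < K p * T}"
proof (intro equalityI subsetI)
  have KT: "K p * T > 0" using K_pos T_pos by simp
  fix z
  show "z \<in> {z. Re z = K p \<and> \<bar>Im z\<bar> < K p * T}" if z: "z \<in> right_open_edge p"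
  proof -
    obtain u where u: "0 < u" "u < 1" "z = (1 - u) *\<^sub>R Complex (K p) (- (K p * T)) + u *\<^sub>R Complex (K p) (K p * T)"
      using z unfolding right_open_edge_def vertex_0 vertex_minus_1 in_segment by auto
    have "\<bar>2 * u - 1\<bar> * (K p * T) < 1 * (K p * T)"
      using u KT by (intro mult_strict_right_mono) (auto simp: abs_less_iff)
    moreover have "Im z = (2 * u - 1) * (K p * T)" "Re z = K p"
      unfolding u(3) by (simp_all add: algebra_simps)
    ultimately show ?thesis using K_pos T_pos by (simp add: abs_mult)
  qed
  show "z \<in> right_open_edge p" if z: "z \<in> {z. Re z = K p \<and> \<bar>Im z\<bar> < K p * T}"
  proof -
    obtain C where C: "C = K p * T" "C > 0" using KT by simp
    define u where "u = (Im z + C) / (2 * C)"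
    have u: "0 < u" "u < 1"
      using z C(2) unfolding u_def C(1)[symmetric] by (auto simp: divide_simps)
    have "(2 * u - 1) * C = Im z"
      using C(2) by (auto simp: u_def field_simps)
    then have "z = (1 - u) *\<^sub>R Complex (K p) (- (K p * T)) + u *\<^sub>R Complex (K p) (K p * T)"
      unfolding C(1)[symmetric] using z by (auto simp: complex_eq_iff algebra_simps)
    then show ?thesis
      using u KT unfolding right_open_edge_def vertex_0 vertex_minus_1 in_segment by auto
  qed
qed

text \<open>The image is open, so it remains to show it relatively closed in the connected polygon.
  A limit point inside the polygon keeps a positive distance from all edge lines, whereas images of
  points near the unit circle do not; near the limit point the image therefore comes from a smaller
  closed disc, whose image is compact.\<close>

lemma open_pgon_subset: "open_pgon p \<subseteq> f ` ball 0 1"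
proof -
  let ?P = "open_pgon p" and ?D = "f ` ball 0 1"
  have oD: "open ?D"
    using f_inj_on[OF convex_ball ball_\<Omega>] f_holomorphic[OF ball_\<Omega>] by (intro open_mapping_thm3) auto
  have cP: "connected ?P" and oP: "open ?P"
    unfolding open_pgon_def by (auto intro: convex_connected convex_interior)
  have closed: "z \<in> ?D" if z: "z \<in> ?P" "z \<in> closure ?D" for z
  proof -
    define ks where "ks = {- int p..int p}"
    define m where "m = Max ((\<lambda>k. Re (\<omega> k * z)) ` ks)"
    have "m < K p" unfolding m_def using open_pgon_halfplane[OF z(1)] by (subst Max_less_iff) (auto simp: ks_def)
    then obtain r where r: "0 < r" "r < 1" "\<delta> r \<le> (K p - m) / 2"
      using \<delta>_small[of "(K p - m) / 2"] by auto
    \<comment> \<open>\<open>K p - m\<close> is the smallest gap between \<open>z\<close> and the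
      edge lines. Values in \<open>Z\<close> are more than \<open>\<delta> r\<close> short of every
      edge line, so by \<open>f_near_edge\<close> their preimages satisfy
      \<open>norm w \<le> r\<close>.\<close>
    define Z where "Z = (\<Inter>k\<in>ks. {w. Re (\<omega> k * w) < K p - \<delta> r})"
    have "open Z" unfolding Z_def
      by (intro open_INT ballI open_Collect_less continuous_intros) (auto simp: ks_def)
    have "Re (\<omega> k * z) < K p - \<delta> r" if "k \<in> ks" for k
    proof -
      have "Re (\<omega> k * z) \<le> m" unfolding m_def using that by (intro Max_ge) (auto simp: ks_def)
      then show ?thesis using r(3) \<open>m < K p\<close> by argo
    qed
    then have "z \<in> Z" by (simp add: Z_def)
    have sub: "Z \<inter> ?D \<subseteq> f ` cball 0 r"
    proof
      fix y assume y: "y \<in> Z \<inter> ?D"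
      then obtain w where w: "norm w < 1" "y = f w" by auto
      obtain k where k: "k \<in> ks" "Re (\<omega> k * f w) \<ge> K p - \<delta> (norm w)"
        using f_near_edge[OF w(1)] unfolding ks_def by blast
      have "\<delta> r < \<delta> (norm w)" using y k w by (force simp: Z_def)
      have "norm w \<le> r"
      proof (rule ccontr)
        assume "\<not> norm w \<le> r"
        then have "\<delta> (norm w) \<le> \<delta> r"
          unfolding \<delta>_def using w \<beta>_pos by (intro divide_right_mono powr_mono2) auto
        then show False using \<open>\<delta> r < \<delta> (norm w)\<close> by simp
      qed
      then show "y \<in> f ` cball 0 r" using w by auto
    qed
    have "cball 0 r \<subseteq> ball (0::complex) 1" using r by auto
    then have "compact (f ` cball 0 r)"
      using f_cont ball_\<Omega> by (intro compact_continuous_image) auto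
    then have "closure (Z \<inter> ?D) \<subseteq> f ` cball 0 r"
      using sub by (intro closure_minimal compact_imp_closed)
    moreover have "z \<in> closure (Z \<inter> ?D)"
      using open_Int_closure_subset[OF \<open>open Z\<close>, of ?D] \<open>z \<in> Z\<close> z(2) by blast
    ultimately show ?thesis using \<open>cball 0 r \<subseteq> ball 0 1\<close> by blast
  qed
  have "0 \<in> ?D" using f_0 by (metis centre_in_ball image_eqI zero_less_one)
  show ?thesis
  proof (rule ccontr)
    assume "\<not> ?thesis"
    then have "?P \<inter> (- closure ?D) \<noteq> {}" using closed by blast
    moreover have "?P \<subseteq> ?D \<union> (- closure ?D)" using closed by blast
    moreover have "?D \<inter> (- closure ?D) \<inter> ?P = {}" using closure_subset[of ?D] by blast
    ultimately show False
      using connectedD[OF cP oD, of "- closure ?D"] zero_open_pgon \<open>0 \<in> ?D\<close> by blast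
  qed
qed

text \<open>The arc must climb towards the vertex, although \<open>f\<close> is not evaluated there.
  If all heights stayed below \<open>y\<close>, then \<open>Im f\<close> would be at most
  \<open>y + \<delta> r\<close> at radius \<open>r\<close> and angle \<open>pi / p\<close>. By
  symmetry, however, \<open>f\<close> maps that radius into the line of slope \<open>T\<close>, and
  \<open>Re f \<ge> K p - \<delta> r\<close> forces a greater height.\<close>

lemma arc_image_upper:
  assumes "0 \<le> y" "y < K p * T"
  shows "\<exists>\<theta>>0. \<theta> < pi / p \<and> y \<le> Im (f (cis \<theta>))"
proof (rule ccontr)
  assume "\<not> ?thesis"
  then have less: "Im (f (cis \<theta>)) < y" if "0 < \<theta>" "\<theta> < pi / p" for \<theta>
    using that by force
  \<comment> \<open>Chosen so that \<open>e * (1 + T)\<close> is half of the gap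
    \<open>K p * T - y\<close>.\<close>
  define e where "e = (K p * T - y) / (2 * (1 + T))"
  have "e > 0" using assms T_pos by (simp add: e_def)
  then obtain r where r: "0 < r" "r < 1" "\<delta> r \<le> e" using \<delta>_small by blast
  define v where "v = cis (pi / p)"
  have "Im (f (rcis r (pi / p))) \<le> y + \<delta> r"
  proof (rule continuous_le_on_closure[where f="\<lambda>\<theta>. Im (f (rcis r \<theta>))"])
    show "continuous_on (closure {0<..<pi/p}) (\<lambda>\<theta>. Im (f (rcis r \<theta>)))"
      using continuous_f_rcis[of r] r by (intro continuous_intros) auto
    show "pi / p \<in> closure {0<..<pi/p}"
      using angle by (subst closure_greaterThanLessThan) auto
    fix x assume x: "x \<in> {0<..<pi/p}"
    then have "norm (f (cis x) - f (rcis r x)) \<le> \<delta> r" using r by (intro cis_rcis_bound) auto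
    then show "Im (f (rcis r x)) \<le> y + \<delta> r"
      using less[of x] x abs_Im_le_cmod[of "f (cis x) - f (rcis r x)"] by simp
  qed
  moreover have "Im (f (rcis r (pi / p))) = T * Re (f (rcis r (pi / p)))"
  proof -
    define w where "w = rcis r (pi / p)"
    have w\<Omega>: "w \<in> \<Omega>" "cnj w \<in> \<Omega>" using r ball_\<Omega> by (auto simp: w_def)
    \<comment> \<open>Conjugation followed by the rotation through \<open>2 * pi / p\<close> is the
      reflection in the ray of angle \<open>pi / p\<close>. It fixes \<open>w\<close> and commutes
      with \<open>f\<close>, so it fixes \<open>f w\<close>.\<close>
    have "w = \<omega> (- 1) * cnj w"
      by (simp add: w_def \<omega>_def rcis_def cis_cnj cis_mult)
    then have "f w = \<omega> (- 1) * cnj (f w)"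
      using f_mult_root[OF \<omega>_power w\<Omega>(2), of "-1"] f_cnj[OF w\<Omega>(1)] by simp
    moreover have "- (pi / p) + - (2 * pi * of_int (- 1) / p) = pi / p" by (simp add: field_simps)
    then have vv: "cnj v * \<omega> (- 1) = v"
      unfolding v_def \<omega>_def cis_cnj cis_mult by (simp only:)
    ultimately have eq: "cnj v * f w = v * cnj (f w)"
      using vv by (metis mult.assoc)
    have "cos (pi / p) > 0" using angle by (intro cos_gt_zero_pi) linarith+
    moreover have "cos (pi / p) * Im (f w) = sin (pi / p) * Re (f w)"
      using arg_cong[OF eq, of Im] by (simp add: v_def mult.commute)
    ultimately show ?thesis unfolding w_def T_def tan_def by (simp add: field_simps)
  qed
  moreover have "Re (f (rcis r (pi / p))) \<ge> K p - \<delta> r"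
    using r angle by (intro Re_f_sector_ge) auto
  then have "T * (K p - \<delta> r) \<le> T * Re (f (rcis r (pi / p)))" using T_pos by simp
  ultimately have "K p * T - y \<le> \<delta> r * (1 + T)" by (simp add: algebra_simps)
  also have "\<dots> \<le> e * (1 + T)" using r T_pos by (intro mult_right_mono) auto
  also have "\<dots> = (K p * T - y) / 2" using T_pos by (simp add: e_def field_simps)
  finally show False using assms by (simp add: mult.commute)
qed

lemma edge_subset_arc_image:
  assumes "z \<in> right_open_edge p"
  obtains \<theta> where "\<bar>\<theta>\<bar> < pi / p" "f (cis \<theta>) = z"
proof -
  have z: "Re z = K p" "\<bar>Im z\<bar> < K p * T" using assms by (auto simp: right_open_edge_eq)
  obtain t where t: "0 < t" "t < pi / p" "\<bar>Im z\<bar> \<le> Im (f (cis t))"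
    using arc_image_upper[OF _ z(2)] by auto
  have "\<exists>x\<ge>0. x \<le> t \<and> Im (f (cis x)) = \<bar>Im z\<bar>"
  proof (rule IVT')
    have "continuous_on {0..t} (\<lambda>x. f (cis x))"
      using t cis_\<Omega> by (intro continuous_on_compose2[OF f_cont[OF subset_refl]] continuous_intros) force
    then show "continuous_on {0..t} (\<lambda>x. Im (f (cis x)))" by (intro continuous_intros)
  qed (use t in \<open>auto simp: f_1\<close>)
  then obtain x where x: "0 \<le> x" "x \<le> t" "Im (f (cis x)) = \<bar>Im z\<bar>" by blast
  show ?thesis
  proof (cases "Im z \<ge> 0")
    case True
    then show ?thesis using that[of x] x t z Re_f_cis[of x] by (simp add: complex_eq_iff)
  next
    case False
    have "f (cis (- x)) = cnj (f (cis x))" using f_cnj[OF cis_\<Omega>[of x]] x t by (simp add: cis_cnj)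
    then show ?thesis using that[of "-x"] False x t z Re_f_cis[of x] by (simp add: complex_eq_iff)
  qed
qed

section \<open>Inverse branches and gluing\<close>

text \<open>The component \<open>c\<close> as a function of \<open>w = s / c\<close>, from
  \<open>c ^ p * (1 + w ^ p) = 1\<close>. It uses the same logarithm as \<open>q\<close>, hence the
  matching branch with \<open>cc w ^ 2 = q w\<close>.\<close>

definition cc :: "complex \<Rightarrow> complex" where
  "cc w = exp (- (1 / of_nat p) * Ln (1 + w ^ p))"

lemma cc_nonzero: "cc w \<noteq> 0"
  by (simp add: cc_def)

lemma cc_power2: "cc w ^ 2 = q w"
proof -
  have "cc w ^ 2 = exp (of_nat 2 * (- (1 / of_nat p) * Ln (1 + w ^ p)))"
    unfolding cc_def by (rule exp_of_nat_mult[symmetric])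
  then show ?thesis by (simp add: q_def)
qed

lemma cc_power_p:
  assumes "w \<in> \<Omega>" shows "cc w ^ p * (1 + w ^ p) = 1"
proof -
  have nz: "1 + w ^ p \<noteq> 0" using assms by (auto simp: \<Omega>_def)
  have "cc w ^ p = exp (of_nat p * (- (1 / of_nat p) * Ln (1 + w ^ p)))"
    unfolding cc_def by (rule exp_of_nat_mult[symmetric])
  also have "\<dots> = exp (- Ln (1 + w ^ p))" using p_gt by simp
  finally show ?thesis using nz by (simp add: exp_minus)
qed

lemma cc_deriv:
  assumes "w \<in> \<Omega>"
  shows "(cc has_field_derivative - (w ^ (p - 1) * cc w ^ (p + 1))) (at w)"
proof -
  have \<Omega>: "1 + w ^ p \<notin> \<real>\<^sub>\<le>\<^sub>0" using assms by (auto simp: \<Omega>_def)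
  then have nz: "1 + w ^ p \<noteq> 0" by auto
  have 1: "((\<lambda>w. 1 + w ^ p) has_field_derivative of_nat p * w ^ (p - 1)) (at w)"
    by (auto intro!: derivative_eq_intros)
  have 2: "((\<lambda>w. Ln (1 + w ^ p)) has_field_derivative inverse (1 + w ^ p) * (of_nat p * w ^ (p - 1))) (at w)"
    by (rule DERIV_chain2[OF has_field_derivative_Ln[OF \<Omega>] 1])
  have "(cc has_field_derivative
      exp (- (1 / of_nat p) * Ln (1 + w ^ p)) * (- (1 / of_nat p) * (inverse (1 + w ^ p) * (of_nat p * w ^ (p - 1))))) (at w)"
    unfolding cc_def by (rule DERIV_chain2[OF DERIV_exp DERIV_cmult[OF 2]])
  moreover have "exp (- (1 / of_nat p) * Ln (1 + w ^ p)) * (- (1 / of_nat p) * (inverse (1 + w ^ p) * (of_nat p * w ^ (p - 1))))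
      = - (w ^ (p - 1) * (cc w * inverse (1 + w ^ p)))"
    using p_gt by (simp add: cc_def)
  moreover have "inverse (1 + w ^ p) = cc w ^ p"
    using cc_power_p[OF assms] nz by (simp add: field_simps)
  ultimately show ?thesis by simp
qed

definition inv_on :: "complex set \<Rightarrow> complex \<Rightarrow> complex" where
  "inv_on S = the_inv_into S f"

definition sol_c :: "complex set \<Rightarrow> complex \<Rightarrow> complex" where
  "sol_c S z = cc (inv_on S z)"

definition sol_s :: "complex set \<Rightarrow> complex \<Rightarrow> complex" where
  "sol_s S z = inv_on S z * cc (inv_on S z)"

lemma inv_on_f:
  assumes "convex S" "S \<subseteq> \<Omega>" "w \<in> S" shows "inv_on S (f w) = w"
  unfolding inv_on_def using f_inj_on assms by (intro the_inv_into_f_f) auto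

lemma inv_on_deriv:
  assumes S: "open S" "convex S" "S \<subseteq> \<Omega>" and z: "z \<in> f ` S"
  shows "(inv_on S has_field_derivative inverse (q (inv_on S z))) (at z)"
proof -
  have hol: "f holomorphic_on S" and inj: "inj_on f S"
    using f_holomorphic f_inj_on S by auto
  have o: "open (f ` S)" by (rule open_mapping_thm3[OF hol S(1) inj])
  obtain g where g: "g holomorphic_on (f ` S)" "\<And>w. w \<in> S \<Longrightarrow> deriv f w * deriv g (f w) = 1"
    "\<And>w. w \<in> S \<Longrightarrow> g (f w) = w"
    using holomorphic_has_inverse[OF hol S(1) inj] by metis
  obtain w where w: "w \<in> S" "z = f w" using z by auto
  have "deriv f w = q w" using f_deriv S w by (intro DERIV_imp_deriv) auto
  then have "q (inv_on S z) * deriv g z = 1"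
    using g(2)[OF w(1)] inv_on_f[OF S(2,3) w(1)] w(2) by simp
  then have "deriv g z = inverse (q (inv_on S z))" by (rule inverse_unique[symmetric])
  then have "(g has_field_derivative inverse (q (inv_on S z))) (at z)"
    using holomorphic_derivI[OF g(1) o z] by simp
  then show ?thesis
    by (rule has_field_derivative_transform_within_open[OF _ o z]) (auto simp: inv_on_f[OF S(2,3)] g(3))
qed

lemma solves_sol:
  assumes S: "open S" "convex S" "S \<subseteq> \<Omega>"
  shows "solves p (f ` S) (sol_s S) (sol_c S)"
  unfolding solves_def
proof
  fix z assume z: "z \<in> f ` S"
  define w where "w = inv_on S z"
  define c where "c = cc w"
  have w\<Omega>: "w \<in> \<Omega>" using z S inv_on_f[OF S(2,3)] by (auto simp: w_def)
  have c0: "c \<noteq> 0" by (simp add: c_def cc_nonzero)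
  have qc: "q w = c ^ 2" by (simp add: c_def cc_power2)
  have c1: "c ^ p * (1 + w ^ p) = 1" using cc_power_p[OF w\<Omega>] by (simp add: c_def)
  obtain m where m: "p = Suc m" using p_gt by (cases p) auto
  have pm: "p - 1 = m" by (simp add: m)
  have dg: "(inv_on S has_field_derivative inverse (c ^ 2)) (at z)"
    using inv_on_deriv[OF S z] by (simp add: qc flip: w_def)
  have dc: "(sol_c S has_field_derivative - (w ^ (p - 1) * c ^ (p + 1)) * inverse (c ^ 2)) (at z)"
    unfolding sol_c_def using cc_deriv[OF w\<Omega>] dg unfolding w_def c_def by (rule DERIV_chain2)
  have e1: "- (w ^ (p - 1) * c ^ (p + 1)) * inverse (c ^ 2) = - (sol_s S z ^ (p - 1))"
    unfolding sol_s_def w_def[symmetric] c_def[symmetric] using c0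
    by (simp add: m power_mult_distrib field_simps power2_eq_square)
  have ds: "(sol_s S has_field_derivative inverse (c ^ 2) * c + (- (w ^ (p - 1) * c ^ (p + 1)) * inverse (c ^ 2)) * w) (at z)"
    using DERIV_mult[OF dg dc] unfolding sol_s_def[abs_def] sol_c_def w_def[symmetric] c_def[symmetric] .
  \<comment> \<open>The factor 1 is kept so that it can be replaced by
    \<open>c ^ p * (1 + w ^ p)\<close>; the terms with \<open>w ^ p\<close> then cancel.\<close>
  have "inverse (c ^ 2) * c + (- (w ^ (p - 1) * c ^ (p + 1)) * inverse (c ^ 2)) * w
      = inverse c * 1 - w ^ p * c ^ m"
    using c0 by (simp add: m field_simps power2_eq_square)
  also have "\<dots> = inverse c * (c ^ p * (1 + w ^ p)) - w ^ p * c ^ m" by (simp only: c1)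
  also have "\<dots> = c ^ m"
    using c0 by (simp add: m field_simps)
  also have "\<dots> = sol_c S z ^ (p - 1)" using pm by (simp add: sol_c_def c_def w_def)
  finally have e2: "inverse (c ^ 2) * c + (- (w ^ (p - 1) * c ^ (p + 1)) * inverse (c ^ 2)) * w = sol_c S z ^ (p - 1)" .
  show "(sol_s S has_field_derivative sol_c S z ^ (p - 1)) (at z) \<and>
        (sol_c S has_field_derivative - (sol_s S z ^ (p - 1))) (at z)"
    using ds[unfolded e2] dc[unfolded e1] by blast
qed

abbreviation disc :: "complex set" where
  "disc \<equiv> ball 0 1"

lemmas inv_on_disc = inv_on_f[OF convex_ball ball_\<Omega>]
lemmas inv_on_sector = inv_on_f[OF convex_sector sector_\<Omega>]
lemmas solves_disc = solves_sol[OF open_ball convex_ball ball_\<Omega>]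
lemmas solves_sector = solves_sol[OF open_sector convex_sector sector_\<Omega>]

lemma open_f_sector: "open (f ` sector)"
  using f_inj_on[OF convex_sector sector_\<Omega>] f_holomorphic[OF sector_\<Omega>] open_sector
  by (intro open_mapping_thm3) auto

lemma sol_uminus:
  assumes "z \<in> f ` disc"
  shows "sol_s disc (- z) = - sol_s disc z" "sol_c disc (- z) = sol_c disc z"
proof -
  obtain w where w: "w \<in> disc" "z = f w" using assms by auto
  have "- z = f (- w)" using f_uminus ball_\<Omega> w by auto
  then have i: "inv_on disc (- z) = - w" "inv_on disc z = w"
    using inv_on_disc[of "- w"] inv_on_disc[of w] w by auto
  have "cc (- w) = cc w" using p_even by (simp add: cc_def)
  then show "sol_s disc (- z) = - sol_s disc z" "sol_c disc (- z) = sol_c disc z"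
    by (simp_all add: sol_s_def sol_c_def i)
qed

lemma sol_sector_eq_disc:
  assumes "z \<in> f ` sector" "Re z < K p"
  shows "sol_s sector z = sol_s disc z" "sol_c sector z = sol_c disc z"
proof -
  obtain w where w: "w \<in> sector" "z = f w" using assms by auto
  then have "w \<in> disc" using norm_lt_1_if_sector assms by simp
  then have "inv_on disc z = w" "inv_on sector z = w"
    using inv_on_disc inv_on_sector w by auto
  then show "sol_s sector z = sol_s disc z" "sol_c sector z = sol_c disc z"
    by (simp_all add: sol_s_def sol_c_def)
qed

text \<open>Near the edge, reflection in its midpoint \<open>K p\<close> exchanges \<open>s\<close> and \<open>c\<close>: both pairs solve the
  system and agree at \<open>K p\<close>, where \<open>s = c\<close>.\<close>

lemma edge_neighbourhood:
  obtains N where "open N" "right_open_edge p \<subseteq> N" "N \<subseteq> f ` sector"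
    "\<And>z. z \<in> N \<Longrightarrow> 0 < Re z \<and> Re z < 2 * K p"
    "\<And>z. z \<in> N \<Longrightarrow> Re z > K p \<Longrightarrow> sol_s sector z = sol_c disc (z - of_real (2 * K p)) \<and>
        sol_c sector z = - sol_s disc (z - of_real (2 * K p))"
proof -
  define h where "h = complex_of_real (2 * K p)"
  define R where "R = {z. 0 < Re z \<and> Re z < 2 * K p \<and> \<bar>Im z\<bar> < K p * T}"
  \<comment> \<open>The sector branch and its reflection are both defined on \<open>M\<close>. The
    rectangle \<open>R\<close> ensures that for \<open>z\<close> right of the edge the point
    \<open>h - z\<close> falls into the polygon.\<close>
  define M where "M = f ` sector \<inter> (\<lambda>z. h - z) -` (f ` sector) \<inter> R"
  \<comment> \<open>Uniqueness needs a connected set through \<open>K p\<close>; this component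
    still contains the whole edge, since the edge is connected.\<close>
  define N where "N = connected_component_set M (of_real (K p))"
  have "open R" unfolding R_def
    by (intro open_Collect_conj open_Collect_less continuous_intros)
  moreover have "open ((\<lambda>z. h - z) -` (f ` sector))"
    by (intro open_vimage open_f_sector continuous_intros)
  ultimately have "open M" unfolding M_def using open_f_sector by blast
  then have N: "open N" "connected N" "N \<subseteq> M"
    unfolding N_def using open_connected_component connected_connected_component connected_component_subset
    by blast+
  have edge: "right_open_edge p \<subseteq> f ` sector"
  proof
    fix z assume "z \<in> right_open_edge p"
    then obtain \<theta> where \<theta>: "\<bar>\<theta>\<bar> < pi / p" "f (cis \<theta>) = z" by (rule edge_subset_arc_image)
    then show "z \<in> f ` sector" using rcis_sector[of 1 \<theta>] by (auto simp: rcis_def)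
  qed
  have eM: "right_open_edge p \<subseteq> M"
  proof
    fix z assume z: "z \<in> right_open_edge p"
    then have "h - z \<in> right_open_edge p" by (auto simp: right_open_edge_eq h_def)
    then show "z \<in> M" using edge z K_pos by (auto simp: M_def R_def right_open_edge_eq)
  qed
  have K_edge: "of_real (K p) \<in> right_open_edge p"
    using K_pos T_pos by (simp add: right_open_edge_eq)
  have eN: "right_open_edge p \<subseteq> N"
    unfolding N_def using K_edge eM
    by (intro connected_component_maximal) (auto simp: right_open_edge_def intro: convex_connected)
  have one: "1 \<in> sector" using T_pos by (simp add: sector_def)
  have "inv_on sector (of_real (K p)) = 1" using inv_on_sector[OF one] by (simp add: f_1)
  then have sc: "sol_s sector (of_real (K p)) = sol_c sector (of_real (K p))"
    by (simp add: sol_s_def sol_c_def)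
  have hK: "h - of_real (K p) = of_real (K p)" by (simp add: h_def)
  have sol: "solves p N (sol_s sector) (sol_c sector)"
    using N(3) by (intro solves_subset[OF solves_sector]) (auto simp: M_def)
  have sol': "solves p N (\<lambda>z. sol_c sector (h - z)) (\<lambda>z. sol_s sector (h - z))"
    using N(3) by (intro solves_subset[OF solves_reflect[OF solves_sector]]) (auto simp: M_def)
  have KN: "of_real (K p) \<in> N" using eN K_edge by blast
  have eqK: "sol_s sector (of_real (K p)) = sol_c sector (h - of_real (K p))"
    "sol_c sector (of_real (K p)) = sol_s sector (h - of_real (K p))"
    unfolding hK by (rule sc, rule sc[symmetric])
  have refl: "sol_s sector z = sol_c sector (h - z)" "sol_c sector z = sol_s sector (h - z)" if "z \<in> N" for z
    by (rule solves_unique[OF N(1,2) KN sol sol' eqK that])+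
  show ?thesis
  proof (rule that[OF N(1) eN])
    show "N \<subseteq> f ` sector" using N(3) by (auto simp: M_def)
    show "0 < Re z \<and> Re z < 2 * K p" if "z \<in> N" for z using N(3) that by (auto simp: M_def R_def)
    fix z assume z: "z \<in> N" "Re z > K p"
    have y: "h - z \<in> f ` sector" "z \<in> R" using N(3) z by (auto simp: M_def)
    have less: "Re (h - z) < K p" using z by (simp add: h_def)
    \<comment> \<open>As \<open>h - z\<close> lies left of the edge, the sector branch there is the
      disc branch, and the parity of \<open>s\<close> and \<open>c\<close> turns
      \<open>h - z\<close> into \<open>z - h\<close>: the reflection becomes a translation with a
      quarter turn.\<close>
    have "h - z \<in> open_pgon p"
      using y(2) z by (intro rectangle_open_pgon) (auto simp: R_def h_def)
    then have "h - z \<in> f ` disc" using open_pgon_subset by blast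
    then have "sol_s disc (z - h) = - sol_s disc (h - z)" "sol_c disc (z - h) = sol_c disc (h - z)"
      using sol_uminus[of "h - z"] by simp_all
    then show "sol_s sector z = sol_c disc (z - of_real (2 * K p)) \<and>
        sol_c sector z = - sol_s disc (z - of_real (2 * K p))"
      using refl[OF z(1)] sol_sector_eq_disc[OF y(1) less] by (simp add: h_def)
  qed
qed

section \<open>The band, its cells and the glued solution\<close>

definition shift :: "int \<Rightarrow> complex" where
  "shift n = of_real (2 * of_int n * K p)"

text \<open>The ceiling makes the cells half open with their right border included, so a common edge
  belongs to the translate on its left.\<close>

definition cell :: "complex \<Rightarrow> int" where
  "cell z = \<lceil>(Re z - K p) / (2 * K p)\<rceil>"

lemma cell_eq_iff: "cell z = n \<longleftrightarrow> - K p < Re (z - shift n) \<and> Re (z - shift n) \<le> K p"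
proof -
  have "cell z = n \<longleftrightarrow> of_int n - 1 < (Re z - K p) / (2 * K p) \<and> (Re z - K p) / (2 * K p) \<le> of_int n"
    unfolding cell_def by (rule ceiling_eq_iff)
  also have "\<dots> \<longleftrightarrow> (of_int n - 1) * (2 * K p) < Re z - K p \<and> Re z - K p \<le> of_int n * (2 * K p)"
    using K_pos by (simp add: pos_less_divide_eq pos_divide_le_eq)
  also have "\<dots> \<longleftrightarrow> - K p < Re (z - shift n) \<and> Re (z - shift n) \<le> K p"
    by (auto simp: shift_def algebra_simps)
  finally show ?thesis .
qed

lemma open_pgon_Re:
  assumes "z \<in> open_pgon p" shows "- K p < Re z" "Re z < K p"
proof -
  have half: "real (p div 2) = p / 2" using p_even by (simp add: real_of_nat_div)
  have "2 * pi * of_int (int (p div 2)) / p = pi"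
    unfolding of_int_of_nat_eq half using p_gt by simp
  then have "\<omega> (int (p div 2)) = -1" unfolding \<omega>_def by (simp only:) (simp add: complex_eq_iff)
  then show "- K p < Re z" using open_pgon_halfplane[OF assms, of "int (p div 2)"] by simp
  show "Re z < K p" using open_pgon_halfplane[OF assms, of 0] by (simp add: \<omega>_def)
qed

definition strip :: "complex set" where
  "strip = {z. \<bar>Im z\<bar> < K p * T}"

text \<open>The edges alone are not open. Absorbing them into the strip, which rectangles and edges
  together fill, presents the band as a union of open connected sets that all contain the
  strip.\<close>

lemma band_eq: "polygonal_band p = (\<Union>n. strip \<union> (\<lambda>z. z + shift n) ` open_pgon p)"
proof -
  have eq: "polygonal_band p = (\<Union>n. (\<lambda>z. z + shift n) ` open_pgon p) \<union> (\<Union>n. (\<lambda>z. z + shift n) ` right_open_edge p)"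
    unfolding polygonal_band_def shift_def by simp
  have edge: "(\<lambda>z. z + shift n) ` right_open_edge p \<subseteq> strip" for n
    by (auto simp: right_open_edge_eq strip_def shift_def)
  have strip: "z \<in> (\<Union>n. (\<lambda>z. z + shift n) ` open_pgon p) \<union> (\<Union>n. (\<lambda>z. z + shift n) ` right_open_edge p)"
    if z: "z \<in> strip" for z
  proof -
    define y where "y = z - shift (cell z)"
    have y: "- K p < Re y" "Re y \<le> K p" "\<bar>Im y\<bar> < K p * T" "z = y + shift (cell z)"
      using cell_eq_iff[of z "cell z"] z by (auto simp: y_def strip_def shift_def)
    have "y \<in> open_pgon p \<or> y \<in> right_open_edge p"
      using y rectangle_open_pgon[of y] by (cases "Re y = K p") (auto simp: right_open_edge_eq)
    then show ?thesis using y(4) by blast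
  qed
  show ?thesis unfolding eq
  proof (intro equalityI Un_least UN_least)
    show "(\<lambda>z. z + shift n) ` open_pgon p \<subseteq> (\<Union>n. strip \<union> (\<lambda>z. z + shift n) ` open_pgon p)" for n
      by blast
    show "(\<lambda>z. z + shift n) ` right_open_edge p \<subseteq> (\<Union>n. strip \<union> (\<lambda>z. z + shift n) ` open_pgon p)" for n
      by (rule order_trans[OF edge]) auto
    show "strip \<subseteq> (\<Union>n. (\<lambda>z. z + shift n) ` open_pgon p) \<union> (\<Union>n. (\<lambda>z. z + shift n) ` right_open_edge p)"
      by (rule subsetI) (rule strip)
    show "(\<lambda>z. z + shift n) ` open_pgon p \<subseteq>
        (\<Union>n. (\<lambda>z. z + shift n) ` open_pgon p) \<union> (\<Union>n. (\<lambda>z. z + shift n) ` right_open_edge p)" for n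
      by (rule subsetI, rule UnI1, rule UN_I) auto
  qed
qed

lemma open_shift_image: "open U \<Longrightarrow> open ((\<lambda>z. z + h) ` U)" for h :: complex
  using open_translation[of U h] by (simp add: add.commute)

lemma open_open_pgon: "open (open_pgon p)"
  by (simp add: open_pgon_def)

lemma open_band: "open (polygonal_band p)"
proof -
  have "open strip" unfolding strip_def by (intro open_Collect_less continuous_intros)
  then show ?thesis unfolding band_eq
    by (intro open_UN ballI open_Un open_shift_image open_open_pgon)
qed

lemma connected_band: "connected (polygonal_band p)"
  unfolding band_eq
proof (rule connected_Union)
  have "strip = {z. Im z < K p * T} \<inter> {z. Im z > - (K p * T)}" by (auto simp: strip_def)
  then have "connected strip" by (simp add: convex_connected convex_Int convex_halfspace_Im_lt convex_halfspace_Im_gt)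
  moreover have "connected ((\<lambda>z. z + shift n) ` open_pgon p)" for n
    unfolding open_pgon_def
    by (intro connected_continuous_image continuous_intros convex_connected convex_interior convex_convex_hull)
  moreover have "shift n \<in> strip \<inter> (\<lambda>z. z + shift n) ` open_pgon p" for n
    using zero_open_pgon K_pos T_pos by (auto simp: strip_def shift_def image_iff)
  ultimately have "connected (strip \<union> (\<lambda>z. z + shift n) ` open_pgon p)" for n
    by (intro connected_Un) blast+
  then show "\<And>s. s \<in> range (\<lambda>n. strip \<union> (\<lambda>z. z + shift n) ` open_pgon p) \<Longrightarrow> connected s" by auto
  have "0 \<in> strip" using K_pos T_pos by (simp add: strip_def)
  then show "\<Inter> (range (\<lambda>n. strip \<union> (\<lambda>z. z + shift n) ` open_pgon p)) \<noteq> {}" by auto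
qed

lemma zero_band: "0 \<in> polygonal_band p"
  unfolding band_eq using K_pos T_pos by (auto simp: strip_def)

text \<open>Edge points are images of the unit circle, outside the open disc; there the sector
  branch supplies the value.\<close>

definition cell_s :: "complex \<Rightarrow> complex" where
  "cell_s z = (if Re z < K p then sol_s disc z else sol_s sector z)"

definition cell_c :: "complex \<Rightarrow> complex" where
  "cell_c z = (if Re z < K p then sol_c disc z else sol_c sector z)"

definition band_s :: "complex \<Rightarrow> complex" where
  "band_s z = rot_a (cell z) * cell_s (z - shift (cell z)) + rot_b (cell z) * cell_c (z - shift (cell z))"

definition band_c :: "complex \<Rightarrow> complex" where
  "band_c z = rot_a (cell z) * cell_c (z - shift (cell z)) - rot_b (cell z) * cell_s (z - shift (cell z))"

text \<open>Inside a translate the index \<open>n\<close> is constant and the pair is a turned disc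
  solution. Near an edge the local solution is the turned sector branch: left of and on the edge it
  agrees with cell \<open>n\<close>, and beyond it the jump of the index to \<open>n + 1\<close> is
  compensated by the extra quarter turn from \<open>edge_neighbourhood\<close>.\<close>

lemma solves_band: "solves p (polygonal_band p) band_s band_c"
proof (rule solves_local)
  fix z assume "z \<in> polygonal_band p"
  then obtain n where "z \<in> (\<lambda>z. z + shift n) ` open_pgon p \<or> z \<in> (\<lambda>z. z + shift n) ` right_open_edge p"
    unfolding polygonal_band_def shift_def by auto
  then consider "z \<in> (\<lambda>z. z + shift n) ` open_pgon p" | "z \<in> (\<lambda>z. z + shift n) ` right_open_edge p" by blast
  then show "\<exists>V s' c'. open V \<and> z \<in> V \<and> solves p V s' c' \<and> (\<forall>y\<in>V. band_s y = s' y \<and> band_c y = c' y)"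
  proof cases
    case 1
    let ?V = "(\<lambda>z. z + shift n) ` open_pgon p"
    let ?s = "\<lambda>z. rot_a n * sol_s disc (z - shift n) + rot_b n * sol_c disc (z - shift n)"
    let ?c = "\<lambda>z. rot_a n * sol_c disc (z - shift n) - rot_b n * sol_s disc (z - shift n)"
    have "solves p ?V ?s ?c"
      using p_gt p_even by (intro solves_rot_shift solves_subset[OF solves_disc open_pgon_subset]) auto
    moreover have "band_s y = ?s y \<and> band_c y = ?c y" if "y \<in> ?V" for y
    proof -
      have "y - shift n \<in> open_pgon p" using that by auto
      then have "- K p < Re (y - shift n)" "Re (y - shift n) < K p" by (rule open_pgon_Re)+
      moreover from this have "cell y = n" by (subst cell_eq_iff) simp
      ultimately show ?thesis by (simp only: band_s_def band_c_def cell_s_def cell_c_def if_True)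
    qed
    ultimately show ?thesis using 1 open_shift_image[OF open_open_pgon] by blast
  next
    case 2
    obtain N where N: "open N" "right_open_edge p \<subseteq> N" "N \<subseteq> f ` sector"
      "\<And>z. z \<in> N \<Longrightarrow> 0 < Re z \<and> Re z < 2 * K p"
      and right: "\<And>z. z \<in> N \<Longrightarrow> Re z > K p \<Longrightarrow> sol_s sector z = sol_c disc (z - of_real (2 * K p)) \<and>
        sol_c sector z = - sol_s disc (z - of_real (2 * K p))"
      using edge_neighbourhood by blast
    let ?V = "(\<lambda>z. z + shift n) ` N"
    let ?s = "\<lambda>z. rot_a n * sol_s sector (z - shift n) + rot_b n * sol_c sector (z - shift n)"
    let ?c = "\<lambda>z. rot_a n * sol_c sector (z - shift n) - rot_b n * sol_s sector (z - shift n)"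
    have "solves p ?V ?s ?c"
      using p_gt p_even by (intro solves_rot_shift solves_subset[OF solves_sector N(3)]) auto
    moreover have "band_s y = ?s y \<and> band_c y = ?c y" if "y \<in> ?V" for y
    proof -
      define x where "x = y - shift n"
      have x: "x \<in> N" using that by (auto simp: x_def)
      show ?thesis
      proof (cases "Re x \<le> K p")
        case True
        then have "cell y = n" unfolding cell_eq_iff x_def[symmetric] using N(4)[OF x] K_pos by auto
        moreover have "cell_s x = sol_s sector x" "cell_c x = sol_c sector x"
          using sol_sector_eq_disc[of x] N(3) x by (auto simp: cell_s_def cell_c_def)
        ultimately show ?thesis by (simp add: band_s_def band_c_def x_def)
      next
        case False
        have sh: "y - shift (n + 1) = x - of_real (2 * K p)" by (simp add: x_def shift_def algebra_simps)
        have "cell y = n + 1" unfolding cell_eq_iff sh using N(4)[OF x] False by auto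
        moreover have "cell_s (x - of_real (2 * K p)) = sol_s disc (x - of_real (2 * K p))"
          "cell_c (x - of_real (2 * K p)) = sol_c disc (x - of_real (2 * K p))"
          using N(4)[OF x] K_pos by (auto simp: cell_s_def cell_c_def)
        ultimately show ?thesis
          using right[OF x] False
          by (simp add: band_s_def band_c_def sh rot_a_Suc rot_b_Suc flip: x_def)
      qed
    qed
    ultimately show ?thesis using 2 N(2) open_shift_image[OF N(1)] by blast
  qed
qed

lemma band_0: "band_s 0 = 0" "band_c 0 = 1"
proof -
  have "cell 0 = 0" unfolding cell_eq_iff using K_pos by (simp add: shift_def)
  moreover have "inv_on disc 0 = 0" using inv_on_disc[of 0] by simp
  ultimately show "band_s 0 = 0" "band_c 0 = 1"
    using K_pos p_gt by (auto simp: band_s_def band_c_def cell_s_def cell_c_def sol_s_def sol_c_def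
        shift_def rot_a_def rot_b_def cc_def power_0_left)
qed

end

theorem theorem20:
  fixes p :: nat
  assumes "p > 2" and "even p"
  shows "\<exists>s c. holomorphic_solution_pair p (polygonal_band p) s c \<and>
           (\<forall>s' c'. holomorphic_solution_pair p (polygonal_band p) s' c' \<longrightarrow>
              (\<forall>z\<in>polygonal_band p. s' z = s z \<and> c' z = c z))"
proof -
  interpret sc_polygon p using assms by unfold_locales
  let ?B = "polygonal_band p"
  have "holomorphic_solution_pair p ?B band_s band_c"
    using open_band connected_band zero_band solves_holomorphic[OF solves_band] solves_band band_0
    by (simp add: holomorphic_solution_pair_def solves_def)
  moreover have "s' z = band_s z \<and> c' z = band_c z"
    if h: "holomorphic_solution_pair p ?B s' c'" and z: "z \<in> ?B" for s' c' z
  proof -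
    have "solves p ?B s' c'" "s' 0 = band_s 0" "c' 0 = band_c 0"
      using h band_0 by (auto simp: holomorphic_solution_pair_def solves_def)
    then show ?thesis
      using solves_unique[OF open_band connected_band zero_band _ solves_band _ _ z] by blast
  qed
  ultimately show ?thesis by blast
qed

end
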